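(* There exists a deterministic polynomial-time oracle algorithm which, for every $P$-hyperbolic polynomial $p(x_1,\dots,x_n)$ (homogeneous of degree $n$ in $n$ variables) with nonnegative integer coefficients given as an oracle, computes a number $F(p)$ satisfying $$\frac{\partial^n}{\partial x_1\cdots\partial x_n}p(0,\dots,0)\ \le\ F(p)\ \le\ e^n\,\frac{\partial^n}{\partial x_1\cdots\partial x_n}p(0,\dots,0).$$
   Context: A homogeneous real polynomial $p(x)$, $x\in\mathbb{R}^m$, of degree $n$ is called hyperbolic in the direction $d\in\mathbb{R}^m$ if $p(d)>0$ and for every $x\in\mathbb{R}^m$ the polynomial $\lambda\mapsto p(x-\lambda d)$ has exactly $n$ real roots, counted with multiplicity, denoted $\lambda_1(x)\ge\dots\ge\lambda_n(x)$. A vector $x$ is $d$-nonnegative if $\lambda_n(x)\ge 0$. A homogeneous polynomial $p$ of degree $n$ in $n$ real variables is called $P$-hyperbolic if it is hyperbolic in the direction $(1,1,\dots,1)$ (in particular $p(1,\dots,1)>0$) and every vector of the nonnegative orthant $\mathbb{R}^n_+$ is $(1,\dots,1)$-nonnegative. "Given as an oracle" means that the list of coefficients of $p$ is not available, but $p(x_1,\dots,x_n)$ can be evaluated on rational inputs. An algorithm is called deterministic polynomial-time oracle if it is deterministic and evaluates $p$ at a number of rational vectors $(q_1,\dots,q_n)$ that is polynomial in $n$ and $\log(p(1,1,\dots,1))$; these rational vectors have bit-wise complexity polynomial in $n$ and $\log(p(1,1,\dots,1))$; and the additional auxiliary arithmetic computations also take a number of steps polynomial in $n$ and $\log(p(1,1,\dots,1))$.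 In the displayed inequality the number $e$ in $e^n$ is the base of the natural logarithm. *)

theory Defs
  imports "HOL-Analysis.Analysis" "HOL-Library.Poly_Mapping" "HOL-Library.Log_Nat"
    "HOL-Computational_Algebra.Polynomial"
begin

section \<open>Hyperbolic polynomials\<close>

text \<open>
  A real polynomial is a finitely supported map from exponents to coefficients. The variables
  are indexed by natural numbers, and a polynomial in \<open>m\<close> variables uses only the
  variables \<open>0, \<dots>, m - 1\<close>. A point of \<open>\<real>\<^sup>m\<close> is a function
  \<^typ>\<open>nat \<Rightarrow> real\<close>, of which only the first \<open>m\<close> values matter.
\<close>

type_synonym mpoly = "(nat \<Rightarrow>\<^sub>0 nat) \<Rightarrow>\<^sub>0 real"

text \<open>Substitution of \<open>x i\<close> for the variable \<open>i\<close>, the coefficients being embedded by \<open>h\<close>.\<close>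

definition mpoly_subst :: "(real \<Rightarrow> 'a::comm_ring_1) \<Rightarrow> mpoly \<Rightarrow> (nat \<Rightarrow> 'a) \<Rightarrow> 'a" where
  "mpoly_subst h p x =
     (\<Sum>\<alpha>\<in>Poly_Mapping.keys p. h (Poly_Mapping.lookup p \<alpha>) *
        (\<Prod>i\<in>Poly_Mapping.keys \<alpha>. x i ^ Poly_Mapping.lookup \<alpha> i))"

definition mpoly_eval :: "mpoly \<Rightarrow> (nat \<Rightarrow> real) \<Rightarrow> real" where
  "mpoly_eval p x = mpoly_subst (\<lambda>c. c) p x"

definition homogeneous :: "nat \<Rightarrow> nat \<Rightarrow> mpoly \<Rightarrow> bool" where
  "homogeneous m n p \<longleftrightarrow>
     (\<forall>\<alpha>\<in>Poly_Mapping.keys p. Poly_Mapping.keys \<alpha> \<subseteq> {..<m} \<and>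
        (\<Sum>i\<in>Poly_Mapping.keys \<alpha>. Poly_Mapping.lookup \<alpha> i) = n)"

text \<open>The univariate polynomial \<open>\<lambda> \<mapsto> p(x - \<lambda> d)\<close>; see \<open>poly_line_poly\<close> below.\<close>

definition line_poly :: "mpoly \<Rightarrow> (nat \<Rightarrow> real) \<Rightarrow> (nat \<Rightarrow> real) \<Rightarrow> real poly" where
  "line_poly p d x = mpoly_subst (\<lambda>c. [:c:]) p (\<lambda>i. [:x i, - d i:])"

lemma poly_line_poly: "poly (line_poly p d x) t = mpoly_eval p (\<lambda>i. x i - t * d i)"
  by (simp add: line_poly_def mpoly_eval_def mpoly_subst_def poly_sum poly_prod)

definition hyperbolic :: "nat \<Rightarrow> nat \<Rightarrow> (nat \<Rightarrow> real) \<Rightarrow> mpoly \<Rightarrow> bool" where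
  "hyperbolic m n d p \<longleftrightarrow>
     homogeneous m n p \<and> mpoly_eval p d > 0 \<and> (\<forall>x. size (proots (line_poly p d x)) = n)"

text \<open>The \<open>k\<close>-th largest root, counted with multiplicity, for \<open>k = 1, \<dots>, n\<close>.\<close>

definition hyp_root :: "mpoly \<Rightarrow> (nat \<Rightarrow> real) \<Rightarrow> nat \<Rightarrow> (nat \<Rightarrow> real) \<Rightarrow> real" where
  "hyp_root p d k x = rev (sorted_list_of_multiset (proots (line_poly p d x))) ! (k - 1)"

definition d_nonnegative :: "nat \<Rightarrow> mpoly \<Rightarrow> (nat \<Rightarrow> real) \<Rightarrow> (nat \<Rightarrow> real) \<Rightarrow> bool" where
  "d_nonnegative n p d x \<longleftrightarrow> hyp_root p d n x \<ge> 0"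

definition P_hyperbolic :: "nat \<Rightarrow> mpoly \<Rightarrow> bool" where
  "P_hyperbolic n p \<longleftrightarrow>
     hyperbolic n n (\<lambda>_. 1) p \<and>
     (\<forall>x. (\<forall>i<n. x i \<ge> 0) \<longrightarrow> d_nonnegative n p (\<lambda>_. 1) x)"

definition nonneg_int_coeffs :: "mpoly \<Rightarrow> bool" where
  "nonneg_int_coeffs p \<longleftrightarrow> (\<forall>\<alpha>. Poly_Mapping.lookup p \<alpha> \<in> \<nat>)"

definition partial_deriv :: "nat \<Rightarrow> ((nat \<Rightarrow> real) \<Rightarrow> real) \<Rightarrow> (nat \<Rightarrow> real) \<Rightarrow> real" where
  "partial_deriv i f = (\<lambda>x. deriv (\<lambda>t. f (x(i := t))) (x i))"

text \<open>
  The value at the origin of \<open>\<partial>\<^sup>n p / \<partial>x\<^sub>0 \<dots> \<partial>x\<^bsub>n-1\<^esub>\<close>.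
\<close>

definition mixed_derivative :: "nat \<Rightarrow> mpoly \<Rightarrow> real" where
  "mixed_derivative n p = foldr partial_deriv [0..<n] (mpoly_eval p) (\<lambda>_. 0)"


section \<open>Deterministic oracle algorithms\<close>

text \<open>
  Algorithms are programs over exact rational arithmetic. A store consists of arrays
  (named by natural numbers) of rational cells. The index of a cell is itself a rational
  number: this makes every indexed access meaningful without a convention for indices that
  are not natural numbers. A run touches only finitely many cells.

  One step is charged for every constant, cell access, arithmetic operation, assignment,
  comparison and oracle call.
\<close>

type_synonym store = "nat \<Rightarrow> rat \<Rightarrow> rat"

datatype aexp =
    Const rat
  | Cell nat aexp
  | Add aexp aexp
  | Sub aexp aexp
  | Mul aexp aexp
  | Div aexp aexp

fun aval :: "aexp \<Rightarrow> store \<Rightarrow> rat" where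
  "aval (Const c) s = c"
| "aval (Cell a e) s = s a (aval e s)"
| "aval (Add e1 e2) s = aval e1 s + aval e2 s"
| "aval (Sub e1 e2) s = aval e1 s - aval e2 s"
| "aval (Mul e1 e2) s = aval e1 s * aval e2 s"
| "aval (Div e1 e2) s = aval e1 s / aval e2 s"

fun asteps :: "aexp \<Rightarrow> nat" where
  "asteps (Const c) = 1"
| "asteps (Cell a e) = 1 + asteps e"
| "asteps (Add e1 e2) = 1 + asteps e1 + asteps e2"
| "asteps (Sub e1 e2) = 1 + asteps e1 + asteps e2"
| "asteps (Mul e1 e2) = 1 + asteps e1 + asteps e2"
| "asteps (Div e1 e2) = 1 + asteps e1 + asteps e2"

text \<open>
  \<open>Assign a i e\<close> performs \<open>a[i] := e\<close>. \<open>Query a i b\<close> performs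
  \<open>a[i] := p(b[0], \<dots>, b[n-1])\<close> and is the only access to the polynomial. The guard of
  \<open>IfLess e1 e2\<close> and \<open>WhileLess e1 e2\<close> is \<open>e1 < e2\<close>.
\<close>

datatype com =
    Skip
  | Assign nat aexp aexp
  | Query nat aexp nat
  | Seq com com
  | IfLess aexp aexp com com
  | WhileLess aexp aexp com

definition store_update :: "store \<Rightarrow> nat \<Rightarrow> rat \<Rightarrow> rat \<Rightarrow> store" where
  "store_update s a i v = s(a := (s a)(i := v))"

text \<open>
  \<open>exec f n c s s' qs t\<close>: with oracle \<open>f\<close> for a function of \<open>n\<close> variables, the
  program \<open>c\<close> started in \<open>s\<close> terminates in \<open>s'\<close> after \<open>t\<close> steps, and \<open>qs\<close> lists the
  vectors at which the oracle was called.
\<close>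

inductive exec ::
  "(rat list \<Rightarrow> rat) \<Rightarrow> nat \<Rightarrow> com \<Rightarrow> store \<Rightarrow> store \<Rightarrow> rat list list \<Rightarrow> nat \<Rightarrow> bool"
  for f :: "rat list \<Rightarrow> rat" and n :: nat where
  Skip: "exec f n Skip s s [] 0"
| Assign: "exec f n (Assign a i e) s (store_update s a (aval i s) (aval e s))
             [] (1 + asteps i + asteps e)"
| Query: "q = map (\<lambda>k. s b (of_nat k)) [0..<n] \<Longrightarrow>
          exec f n (Query a i b) s (store_update s a (aval i s) (f q)) [q] (1 + asteps i)"
| Seq: "exec f n c1 s s' qs t \<Longrightarrow> exec f n c2 s' s'' qs' t' \<Longrightarrow>
        exec f n (Seq c1 c2) s s'' (qs @ qs') (t + t')"
| IfTrue: "aval e1 s < aval e2 s \<Longrightarrow> exec f n c1 s s' qs t \<Longrightarrow>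
           exec f n (IfLess e1 e2 c1 c2) s s' qs (1 + asteps e1 + asteps e2 + t)"
| IfFalse: "\<not> aval e1 s < aval e2 s \<Longrightarrow> exec f n c2 s s' qs t \<Longrightarrow>
            exec f n (IfLess e1 e2 c1 c2) s s' qs (1 + asteps e1 + asteps e2 + t)"
| WhileFalse: "\<not> aval e1 s < aval e2 s \<Longrightarrow>
               exec f n (WhileLess e1 e2 c) s s [] (1 + asteps e1 + asteps e2)"
| WhileTrue: "aval e1 s < aval e2 s \<Longrightarrow> exec f n c s s' qs t \<Longrightarrow>
              exec f n (WhileLess e1 e2 c) s' s'' qs' t' \<Longrightarrow>
              exec f n (WhileLess e1 e2 c) s s'' (qs @ qs')
                (1 + asteps e1 + asteps e2 + t + t')"

inductive_cases exec_SkipE: "exec f n Skip s s' qs t"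
inductive_cases exec_AssignE: "exec f n (Assign a i e) s s' qs t"
inductive_cases exec_QueryE: "exec f n (Query a i b) s s' qs t"
inductive_cases exec_SeqE: "exec f n (Seq c1 c2) s s' qs t"
inductive_cases exec_IfE: "exec f n (IfLess e1 e2 c1 c2) s s' qs t"
inductive_cases exec_WhileE: "exec f n (WhileLess e1 e2 c) s s' qs t"

lemma exec_deterministic:
  assumes "exec f n c s s1 qs1 t1" and "exec f n c s s2 qs2 t2"
  shows "s1 = s2 \<and> qs1 = qs2 \<and> t1 = t2"
  using assms
proof (induction arbitrary: s2 qs2 t2 rule: exec.induct)
  case (Skip s)
  then show ?case by (auto elim: exec_SkipE)
next
  case (Assign a i e s)
  then show ?case by (auto elim: exec_AssignE)
next
  case (Query q s b a i)
  from Query.prems show ?case by (rule exec_QueryE) (simp add: Query.hyps)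
next
  case (Seq c1 s s' qs t c2 s'' qs' t')
  from Seq.prems obtain r qs3 t3 qs4 t4
    where "exec f n c1 s r qs3 t3" "exec f n c2 r s2 qs4 t4" "qs2 = qs3 @ qs4" "t2 = t3 + t4"
    by (rule exec_SeqE)
  with Seq.IH show ?case by metis
next
  case (IfTrue e1 s e2 c1 s' qs t c2)
  from IfTrue.prems show ?case
    by (rule exec_IfE) (use IfTrue.hyps(1) in \<open>auto dest: IfTrue.IH\<close>)
next
  case (IfFalse e1 s e2 c2 s' qs t c1)
  from IfFalse.prems show ?case
    by (rule exec_IfE) (use IfFalse.hyps(1) in \<open>auto dest: IfFalse.IH\<close>)
next
  case (WhileFalse e1 s e2 c)
  from WhileFalse.prems show ?case
    by (rule exec_WhileE) (use WhileFalse.hyps in simp_all)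
next
  case (WhileTrue e1 s e2 c s' qs t s'' qs' t')
  from WhileTrue.prems show ?case
  proof (rule exec_WhileE)
    assume "\<not> aval e1 s < aval e2 s"
    with WhileTrue.hyps(1) show ?thesis by simp
  next
    fix r qs3 t3 qs4 t4
    assume *: "qs2 = qs3 @ qs4" "t2 = Suc (asteps e1 + asteps e2 + t3 + t4)"
      "exec f n c s r qs3 t3" "exec f n (WhileLess e1 e2 c) r s2 qs4 t4"
    have eq: "s' = r" "qs = qs3" "t = t3" using WhileTrue.IH(1)[OF *(3)] by blast+
    have "s'' = s2 \<and> qs' = qs4 \<and> t' = t4"
      by (rule WhileTrue.IH(2)) (use *(4) eq(1) in blast)
    then show ?thesis using *(1,2) eq(2,3) by simp
  qed
qed

text \<open>The number \<open>n\<close> of variables is the input; it is passed in cell 0 of array 0.\<close>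

definition initial_store :: "nat \<Rightarrow> store" where
  "initial_store n = (\<lambda>a i. if a = 0 \<and> i = 0 then of_nat n else 0)"

definition final_output :: "store \<Rightarrow> rat" where
  "final_output s = s 0 0"

definition int_bits :: "int \<Rightarrow> nat" where
  "int_bits k = 1 + floorlog 2 (nat \<bar>k\<bar>)"

definition vector_bits :: "rat list \<Rightarrow> nat" where
  "vector_bits q =
     (\<Sum>r\<leftarrow>q. int_bits (fst (quotient_of r)) + int_bits (snd (quotient_of r)))"

definition is_oracle_for :: "nat \<Rightarrow> mpoly \<Rightarrow> (rat list \<Rightarrow> rat) \<Rightarrow> bool" where
  "is_oracle_for n p f \<longleftrightarrow>
     (\<forall>q. length q = n \<longrightarrow>
        real_of_rat (f q) = mpoly_eval p (\<lambda>i. if i < n then real_of_rat (q ! i) else 0))"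

text \<open>
  A single program \<open>c\<close> computes \<open>F n p\<close> for all pairs \<open>(n, p)\<close> in the class \<open>D\<close>. The
  number of queries, the bit size of each queried vector and the number of steps are polynomial
  in \<open>n\<close> and \<open>ln p(1,\<dots>,1)\<close>. The bound is meaningful for polynomials with
  \<open>p(1,\<dots>,1) \<ge> 1\<close>; this holds if \<open>p\<close> is nonzero with nonnegative integer coefficients.
  Existence of a run suffices for termination with this result by \<open>exec_deterministic\<close>.
\<close>

definition det_poly_time_oracle_computes ::
  "com \<Rightarrow> (nat \<Rightarrow> mpoly \<Rightarrow> bool) \<Rightarrow> (nat \<Rightarrow> mpoly \<Rightarrow> rat) \<Rightarrow> bool" where
  "det_poly_time_oracle_computes c D F \<longleftrightarrow>
     (\<exists>K k :: nat. \<forall>n p f. D n p \<longrightarrow> is_oracle_for n p f \<longrightarrow>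
        (\<exists>s qs t. exec f n c (initial_store n) s qs t \<and> final_output s = F n p \<and>
           (let B = real K * (1 + real n + ln (mpoly_eval p (\<lambda>_. 1))) ^ k in
              real (length qs) \<le> B \<and>
              (\<forall>q\<in>set qs. real (vector_bits q) \<le> B) \<and>
              real t \<le> B)))"

end

theory Submission
  imports Defs "HOL-Complex_Analysis.Complex_Analysis"
    "HOL-Computational_Algebra.Fundamental_Theorem_Algebra"
begin

text \<open>
  Write \<open>p\<close> for a P-hyperbolic polynomial of degree \<open>n\<close> with nonnegative integer coefficients, and
  \<open>f x = p x / (x\<^sub>1 \<cdots> x\<^sub>n)\<close> for \<open>x > 0\<close>. The mixed derivative at the origin is the coefficient of
  \<open>x\<^sub>1 \<cdots> x\<^sub>n\<close>, an integer, and \<open>f\<close> never drops below it. Conversely, the infimum of \<open>f\<close>, known as the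
  capacity of \<open>p\<close>, is at most \<open>e\<^sup>n\<^sup>-\<^sup>1\<close> times that coefficient. Hence a point at which \<open>f\<close> exceeds its infimum
  by a factor of at most \<open>e\<close> yields the required number, and a point at which \<open>f < 1\<close> shows that the
  coefficient vanishes.

  The search for such a point is a multiplicative coordinate descent that starts at \<open>(1, \<dots>, 1)\<close>. With
  \<open>\<delta> = 1 / (2 n (n + 1))\<close>, it multiplies some coordinate by \<open>1 + \<delta>\<close> whenever this lowers \<open>f\<close> by the factor
  \<open>(1 + \<delta> - \<delta>\<^sup>2) / (1 + \<delta>)\<close>, and it stops when no coordinate qualifies or \<open>f < 1\<close>. As \<open>f\<close> starts at \<open>p(1, \<dots>, 1)\<close>,
  there are \<open>O(ln (p(1, \<dots>, 1)) / \<delta>\<^sup>2)\<close> accepted moves. Coordinates are powers of one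
  rational with numerator and denominator polynomial in \<open>n\<close>, so no rounding is needed to keep them short.

  All inequalities come from stability: \<open>p\<close> has no zero with all coordinates in the open upper half-plane
  (\<open>P_hyperbolic_imp_stable\<close>, by deforming the direction \<open>(1, \<dots>, 1)\<close> into any other positive direction).
  A logarithmic derivative of a stable polynomial in a nonnegative direction maps the upper half-plane to
  the closed lower one, so on the positive orthant it does not increase along any nonnegative direction
  (\<open>log_derivative_antimono\<close>). This has three consequences.

  \<^item> Along a coordinate \<open>p\<close> is log-concave. Passing from \<open>p\<close> to the coefficient of \<open>x\<^sub>n\<close> to the first power
  therefore costs at most a factor \<open>e\<close> of the capacity, and it preserves stability; iteration gives the
  upper bound on the capacity (\<open>capacity_le_multilinear_coeff\<close>).

  \<^item> When the search stops, \<open>x\<^sub>j \<partial>\<^sub>j p / p \<ge> 1 - 2 \<delta>\<close> for every \<open>j\<close>.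

  \<^item> Scaling up the variables in a set \<open>S\<close> does not decrease the mean degree
  \<open>\<Sum>\<^sub>j\<^sub>\<in>\<^sub>T x\<^sub>j \<partial>\<^sub>j p / p\<close> of any \<open>T \<subseteq> S\<close>. Up to a common factor, any positive point is reached from the final one
  by scaling up the sets of a decreasing chain of length at most \<open>n\<close>, so along the way the mean degree of
  the next set stays almost as large as its cardinality. Each single scaling concerns a real-rooted polynomial
  in one variable, and it multiplies \<open>f\<close> by at least \<open>1 - 1 / (n + 1)\<close> (\<open>peval_scale_on_ge\<close>). Altogether the final value of \<open>f\<close> is at
  most \<open>(1 + 1 / n)\<^sup>n \<le> e\<close> times the capacity (\<open>near_capacity\<close>).
\<close>

section \<open>Polynomials as lists of terms\<close>

text \<open>
  Lists of coefficients and exponent functions are used here because all operations below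
  (partial derivatives, selection of terms) act term by term and leave the number of variables to
  \<open>peval\<close>.
\<close>

type_synonym terms = "(real \<times> (nat \<Rightarrow> nat)) list"

definition peval :: "nat \<Rightarrow> terms \<Rightarrow> (nat \<Rightarrow> 'a) \<Rightarrow> 'a::real_normed_field" where
  "peval m ts x = (\<Sum>(c, e)\<leftarrow>ts. of_real c * (\<Prod>i<m. x i ^ e i))"

text \<open>
  For exponent \<open>0\<close> the truncated difference is harmless, since the new coefficient is \<open>0\<close>.
\<close>

definition partial :: "nat \<Rightarrow> terms \<Rightarrow> terms" where
  "partial j ts = map (\<lambda>(c, e). (c * real (e j), e(j := e j - 1))) ts"

definition dir_deriv :: "nat \<Rightarrow> terms \<Rightarrow> (nat \<Rightarrow> real) \<Rightarrow> (nat \<Rightarrow> 'a) \<Rightarrow> 'a::real_normed_field" where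
  "dir_deriv m ts u x = (\<Sum>j<m. of_real (u j) * peval m (partial j ts) x)"

definition nonneg :: "terms \<Rightarrow> bool" where
  "nonneg ts \<longleftrightarrow> (\<forall>(c, e)\<in>set ts. c \<ge> 0)"

definition homog :: "nat \<Rightarrow> nat \<Rightarrow> terms \<Rightarrow> bool" where
  "homog m d ts \<longleftrightarrow> (\<forall>(c, e)\<in>set ts. (\<Sum>i<m. e i) = d)"

text \<open>
  The coefficients are real, so this is real stability.
\<close>

definition stable :: "nat \<Rightarrow> terms \<Rightarrow> bool" where
  "stable m ts \<longleftrightarrow> (\<forall>z::nat \<Rightarrow> complex. (\<forall>i<m. Im (z i) > 0) \<longrightarrow> peval m ts z \<noteq> 0)"

lemma peval_Nil [simp]: "peval m [] x = 0"
  by (simp add: peval_def)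

lemma peval_Cons [simp]:
  "peval m ((c, e) # ts) x = of_real c * (\<Prod>i<m. x i ^ e i) + peval m ts x"
  by (simp add: peval_def)

lemma partial_Nil [simp]: "partial j [] = []" and
  partial_Cons [simp]: "partial j ((c, e) # ts) = (c * real (e j), e(j := e j - 1)) # partial j ts"
  by (simp_all add: partial_def)

lemma dir_deriv_Nil [simp]: "dir_deriv m [] u x = 0"
  by (simp add: dir_deriv_def)

lemma dir_deriv_Cons [simp]:
  "dir_deriv m ((c, e) # ts) u x =
     of_real c * (\<Sum>j<m. of_real (u j) * of_nat (e j) * (\<Prod>i<m. x i ^ (e(j := e j - 1)) i)) +
     dir_deriv m ts u x"
  by (simp add: dir_deriv_def sum.distrib sum_distrib_left algebra_simps)

lemma peval_cong:
  assumes "\<And>i. i < m \<Longrightarrow> x i = y i" shows "peval m ts x = peval m ts y"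
proof -
  have "(\<Prod>i<m. x i ^ e i) = (\<Prod>i<m. y i ^ e i)" for e :: "nat \<Rightarrow> nat"
    using assms by (intro prod.cong) auto
  then show ?thesis by (simp add: peval_def)
qed

lemma dir_deriv_cong:
  assumes "\<And>i. i < m \<Longrightarrow> x i = y i" "\<And>i. i < m \<Longrightarrow> u i = v i"
  shows "dir_deriv m ts u x = dir_deriv m ts v y"
  unfolding dir_deriv_def using assms by (intro sum.cong) (auto intro!: peval_cong)

lemma peval_of_real: "peval m ts (\<lambda>i. of_real (x i)) = of_real (peval m ts x)"
  by (induction ts) auto

lemma dir_deriv_of_real: "dir_deriv m ts u (\<lambda>i. of_real (x i)) = of_real (dir_deriv m ts u x)"
  by (simp add: dir_deriv_def peval_of_real)

lemma peval_cnj: "peval m ts (\<lambda>i. cnj (x i)) = cnj (peval m ts x)"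
  by (induction ts) auto

lemma tendsto_peval:
  assumes "\<And>i. i < m \<Longrightarrow> ((\<lambda>y. x y i) \<longlongrightarrow> l i) F"
  shows "((\<lambda>y. peval m ts (x y)) \<longlongrightarrow> peval m ts l) F"
proof (induction ts)
  case (Cons ce ts)
  show ?case
    by (cases ce) (auto intro!: tendsto_intros assms Cons.IH)
qed simp

lemma tendsto_dir_deriv:
  assumes "\<And>i. i < m \<Longrightarrow> ((\<lambda>y. x y i) \<longlongrightarrow> l i) F" "\<And>i. i < m \<Longrightarrow> ((\<lambda>y. u y i) \<longlongrightarrow> v i) F"
  shows "((\<lambda>y. dir_deriv m ts (u y) (x y)) \<longlongrightarrow> dir_deriv m ts v l) F"
  unfolding dir_deriv_def by (intro tendsto_intros tendsto_peval assms) auto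

lemma continuous_on_peval:
  assumes "\<And>i. i < m \<Longrightarrow> continuous_on S (\<lambda>y. x y i)"
  shows "continuous_on S (\<lambda>y. peval m ts (x y))"
  using assms by (auto simp: continuous_on_def intro!: tendsto_peval)

lemma peval_homog:
  assumes "homog m d ts"
  shows "peval m ts (\<lambda>i. w * x i) = w ^ d * peval m ts x"
  using assms
proof (induction ts)
  case (Cons ce ts)
  obtain c e where [simp]: "ce = (c, e)" by force
  have "(\<Prod>i<m. w ^ e i) = w ^ d"
    using Cons.prems by (simp add: homog_def flip: power_sum)
  then show ?case
    using Cons by (simp add: homog_def power_mult_distrib prod.distrib algebra_simps)
qed simp

lemma has_field_derivative_peval:
  "((\<lambda>s. peval m ts (\<lambda>i. x i + s * of_real (u i))) has_field_derivative
     dir_deriv m ts u (\<lambda>i. x i + s * of_real (u i))) (at s)"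
proof (induction ts)
  case (Cons ce ts)
  obtain c e where [simp]: "ce = (c, e)" by force
  define g where "g = (\<lambda>s i. x i + s * of_real (u i))"
  have "((\<lambda>s. \<Prod>i<m. g s i ^ e i) has_field_derivative
      (\<Sum>j<m. of_nat (e j) * g s j ^ (e j - 1) * of_real (u j) * (\<Prod>i\<in>{..<m} - {j}. g s i ^ e i))) (at s)"
    by (rule has_field_derivative_prod) (auto simp: g_def intro!: derivative_eq_intros)
  also have "(\<Sum>j<m. of_nat (e j) * g s j ^ (e j - 1) * of_real (u j) * (\<Prod>i\<in>{..<m} - {j}. g s i ^ e i))
     = (\<Sum>j<m. of_real (u j) * of_nat (e j) * (\<Prod>i<m. g s i ^ (e(j := e j - 1)) i))"
  proof (intro sum.cong refl)
    fix j assume j: "j \<in> {..<m}"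
    have "(\<Prod>i<m. g s i ^ (e(j := e j - 1)) i) = g s j ^ (e j - 1) * (\<Prod>i\<in>{..<m} - {j}. g s i ^ e i)"
      using j by (subst prod.remove[of _ j]) (auto intro!: prod.cong)
    then show "of_nat (e j) * g s j ^ (e j - 1) * of_real (u j) * (\<Prod>i\<in>{..<m} - {j}. g s i ^ e i) =
      of_real (u j) * of_nat (e j) * (\<Prod>i<m. g s i ^ (e(j := e j - 1)) i)"
      by (simp add: algebra_simps)
  qed
  finally have "((\<lambda>s. of_real c * (\<Prod>i<m. g s i ^ e i)) has_field_derivative
      of_real c * (\<Sum>j<m. of_real (u j) * of_nat (e j) * (\<Prod>i<m. g s i ^ (e(j := e j - 1)) i))) (at s)"
    by (rule DERIV_cmult)
  from DERIV_add[OF this Cons.IH] show ?case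
    by (simp add: g_def)
qed simp

lemma has_field_derivative_dir_deriv:
  "((\<lambda>s. dir_deriv m ts v (\<lambda>i. x i + s * of_real (u i))) has_field_derivative
     (\<Sum>j<m. of_real (v j) * dir_deriv m (partial j ts) u (\<lambda>i. x i + s * of_real (u i)))) (at s)"
  unfolding dir_deriv_def[of m ts]
  by (intro DERIV_sum DERIV_cmult has_field_derivative_peval)

lemma peval_line_poly:
  "\<exists>P::'a::real_normed_field poly. \<forall>t. poly P t = peval m ts (\<lambda>i. z i + t * w i)"
proof (induction ts)
  case Nil
  show ?case by (rule exI[of _ 0]) simp
next
  case (Cons ce ts)
  obtain c e where [simp]: "ce = (c, e)" by force
  from Cons obtain P where "\<forall>t. poly P t = peval m ts (\<lambda>i. z i + t * w i)" by blast
  then show ?case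
    by (intro exI[of _ "smult (of_real c) (\<Prod>i<m. [:z i, w i:] ^ e i) + P"])
       (simp add: poly_prod)
qed

lemma peval_nonneg:
  assumes "nonneg ts" "\<And>i. i < m \<Longrightarrow> x i \<ge> (0::real)" shows "peval m ts x \<ge> 0"
  using assms(1)
proof (induction ts)
  case (Cons ce ts)
  then show ?case using assms(2)
    by (cases ce) (auto simp: nonneg_def intro!: add_nonneg_nonneg mult_nonneg_nonneg prod_nonneg)
qed simp

lemma nonneg_partial: "nonneg ts \<Longrightarrow> nonneg (partial j ts)"
  by (induction ts) (auto simp: nonneg_def)

text \<open>
  A nonnegative polynomial that is positive somewhere has a term with a positive
  coefficient, whose monomial is positive on the whole open orthant.
\<close>

lemma peval_pos:
  assumes "nonneg ts" "peval m ts y > (0::real)" "\<And>i. i < m \<Longrightarrow> x i > 0" 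
  shows "peval m ts x > (0::real)"
  using assms(1,2)
proof (induction ts)
  case (Cons ce ts)
  obtain c e where [simp]: "ce = (c, e)" by force
  have pos: "(\<Prod>i<m. x i ^ e i) > 0" using assms(3) by (auto intro!: prod_pos)
  have nn: "nonneg ts" "c \<ge> 0" using Cons.prems by (auto simp: nonneg_def)
  have nn': "peval m ts x \<ge> 0" using nn assms(3) by (intro peval_nonneg) (auto intro: less_imp_le)
  show ?case
  proof (cases "c = 0")
    case True
    then show ?thesis using Cons nn by simp
  next
    case False
    then have "c * (\<Prod>i<m. x i ^ e i) > 0" using nn pos by simp
    then show ?thesis using nn' by simp
  qed
qed simp

section \<open>Stable polynomials and their logarithmic derivatives\<close>

text \<open>
  If all roots lie in the lower half-plane, then every summand \<open>1 / (0 - x)\<close> of the logarithmic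
  derivative at \<open>0\<close> does so as well. Multiplying by the squared modulus of the polynomial keeps the statement
  free of division.
\<close>

lemma poly_upper_halfplane_aux:
  fixes M :: "complex multiset" and c :: complex
  assumes "\<And>x. x \<in># M \<Longrightarrow> Im x < 0"
  defines "f \<equiv> smult c (\<Prod>x\<in>#M. [:-x, 1:])"
  shows "Im (poly (pderiv f) 0 * cnj (poly f 0)) \<le> 0"
  using assms(1) unfolding f_def
proof (induction M)
  case (add x M)
  define g where "g = smult c (\<Prod>x\<in>#M. [:-x, 1:])"
  have IH: "Im (poly (pderiv g) 0 * cnj (poly g 0)) \<le> 0"
    using add by (auto simp: g_def)
  have x: "Im x < 0" using add.prems by auto
  have eq: "smult c (\<Prod>x\<in>#add_mset x M. [:-x, 1:]) = [:-x, 1:] * g"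
    by (simp add: g_def)
  have f0: "poly ([:-x, 1:] * g) 0 = - x * poly g 0" by simp
  have f1: "poly (pderiv ([:-x, 1:] * g)) 0 = poly g 0 - x * poly (pderiv g) 0"
    by (subst pderiv_mult) (simp add: pderiv_pCons)
  have "(poly g 0 - x * poly (pderiv g) 0) * cnj (- x * poly g 0) =
      - cnj x * (poly g 0 * cnj (poly g 0)) + (x * cnj x) * (poly (pderiv g) 0 * cnj (poly g 0))"
    by (simp add: algebra_simps)
  also have "\<dots> = - cnj x * of_real ((cmod (poly g 0))\<^sup>2) + of_real ((cmod x)\<^sup>2) * (poly (pderiv g) 0 * cnj (poly g 0))"
    by (simp only: complex_norm_square)
  finally have "Im ((poly g 0 - x * poly (pderiv g) 0) * cnj (- x * poly g 0)) =
      Im x * (cmod (poly g 0))\<^sup>2 + (cmod x)\<^sup>2 * Im (poly (pderiv g) 0 * cnj (poly g 0))"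
    by simp
  also have "\<dots> \<le> 0"
    using x IH by (intro add_nonpos_nonpos mult_nonpos_nonneg mult_nonneg_nonpos) auto
  finally show ?case unfolding eq f0 f1 .
qed simp

lemma poly_upper_halfplane:
  fixes P :: "complex poly"
  assumes "\<And>t. Im t \<ge> 0 \<Longrightarrow> poly P t \<noteq> 0"
  shows "Im (poly (pderiv P) 0 * cnj (poly P 0)) \<le> 0"
proof -
  have "P \<noteq> 0" using assms[of 0] by auto
  have "Im x < 0" if "x \<in># proots P" for x
    using assms[of x] that \<open>P \<noteq> 0\<close> by (cases "Im x < 0") auto
  from poly_upper_halfplane_aux[OF this, of "proots P" "lead_coeff P"] show ?thesis
    by (simp add: complex_poly_decompose_multiset)
qed

text \<open>
  On the line \<open>z + t v\<close> with \<open>v \<ge> 0\<close> the polynomial has no zeros with \<open>Im t \<ge> 0\<close>.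
\<close>

lemma stable_Im_dir_deriv:
  assumes "stable m ts" "\<And>i. i < m \<Longrightarrow> Im (z i) > 0" "\<And>i. i < m \<Longrightarrow> v i \<ge> 0"
  shows "Im (dir_deriv m ts v z * cnj (peval m ts z)) \<le> 0"
proof -
  obtain P :: "complex poly" where P: "\<And>t. poly P t = peval m ts (\<lambda>i. z i + t * of_real (v i))"
    using peval_line_poly by metis
  have "((\<lambda>t. poly P t) has_field_derivative dir_deriv m ts v (\<lambda>i. z i + 0 * of_real (v i))) (at 0)"
    unfolding P by (rule has_field_derivative_peval)
  from DERIV_unique[OF poly_DERIV this] have d: "poly (pderiv P) 0 = dir_deriv m ts v z"
    by simp
  have "poly P t \<noteq> 0" if "Im t \<ge> 0" for t
    using assms that unfolding P stable_def by (auto simp: add_pos_nonneg)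
  from poly_upper_halfplane[OF this] d P[of 0] show ?thesis by simp
qed

text \<open>
  The strong Rayleigh inequality, for arbitrary nonnegative directions. On the ray \<open>x + \<i> \<eta> u\<close> the
  product of the derivative in direction \<open>v\<close> with the conjugate of the value has nonpositive imaginary part
  and is real at \<open>\<eta> = 0\<close>. The first-order term in \<open>\<eta>\<close> is the difference of the two sides.
\<close>

lemma rayleigh:
  fixes x :: "nat \<Rightarrow> real"
  assumes st: "stable m ts" and u: "\<And>i. i < m \<Longrightarrow> u i \<ge> 0" and v: "\<And>i. i < m \<Longrightarrow> v i \<ge> 0"
  shows "(\<Sum>j<m. v j * dir_deriv m (partial j ts) u x) * peval m ts x \<le> dir_deriv m ts v x * dir_deriv m ts u x"
proof -
  define X :: "nat \<Rightarrow> complex" where "X = (\<lambda>i. of_real (x i))"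
  define N where "N = (\<lambda>\<zeta>. dir_deriv m ts v (\<lambda>i. X i + \<zeta> * of_real (u i)))"
  define A where "A = (\<lambda>\<zeta>. peval m ts (\<lambda>i. X i + \<zeta> * of_real (u i)))"
  \<comment> \<open>As \<open>A\<close> has real coefficients, \<open>A (- \<zeta>)\<close> is the conjugate of \<open>A \<zeta>\<close> for imaginary \<open>\<zeta>\<close>; unlike the
    conjugate it is holomorphic in \<open>\<zeta>\<close>.\<close>
  define M where "M = (\<lambda>\<zeta>. N \<zeta> * A (- \<zeta>))"
  define N1 where "N1 = (\<Sum>j<m. v j * dir_deriv m (partial j ts) u x)"
  have A0: "A 0 = of_real (peval m ts x)" and N0: "N 0 = of_real (dir_deriv m ts v x)"
    by (simp_all add: A_def N_def X_def peval_of_real dir_deriv_of_real)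
  have dA: "(A has_field_derivative of_real (dir_deriv m ts u x)) (at 0)"
    unfolding A_def using has_field_derivative_peval[of m ts X u 0]
    by (simp add: X_def dir_deriv_of_real)
  have dN: "(N has_field_derivative of_real N1) (at 0)"
    unfolding N_def using has_field_derivative_dir_deriv[of m ts v X u 0]
    by (simp add: X_def dir_deriv_of_real N1_def)
  have dA': "((\<lambda>\<zeta>. A (- \<zeta>)) has_field_derivative - of_real (dir_deriv m ts u x)) (at 0)"
    using DERIV_chain'[of "\<lambda>\<zeta>. - \<zeta>" "-1" 0 UNIV A "of_real (dir_deriv m ts u x)"] dA
      DERIV_minus[OF DERIV_ident, of "0 :: complex" UNIV] by simp
  have dM: "(M has_field_derivative of_real (N1 * peval m ts x - dir_deriv m ts v x * dir_deriv m ts u x)) (at 0)"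
    unfolding M_def using DERIV_mult[OF dN dA'] A0 N0 by (simp add: algebra_simps)
  have neg: "Im (M (\<i> * of_real \<eta>)) \<le> 0" if "\<eta> > 0" for \<eta>
  proof -
    \<comment> \<open>The direction \<open>u\<close> may have zero entries, so all imaginary parts are first raised by \<open>\<delta>\<close>.\<close>
    define Z where "Z = (\<lambda>\<delta> i. X i + \<i> * of_real \<eta> * of_real (u i) + \<i> * of_real \<delta>)"
    have lim: "((\<lambda>\<delta>. Im (dir_deriv m ts v (Z \<delta>) * cnj (peval m ts (Z \<delta>)))) \<longlongrightarrow>
            Im (dir_deriv m ts v (Z 0) * cnj (peval m ts (Z 0)))) (at_right 0)"
      unfolding Z_def by (intro tendsto_intros tendsto_dir_deriv tendsto_peval)
    have "\<forall>\<^sub>F \<delta> in at_right 0. Im (dir_deriv m ts v (Z \<delta>) * cnj (peval m ts (Z \<delta>))) \<le> 0"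
    proof (rule eventually_at_right_less[THEN eventually_mono])
      fix \<delta> :: real assume "0 < \<delta>"
      then show "Im (dir_deriv m ts v (Z \<delta>) * cnj (peval m ts (Z \<delta>))) \<le> 0"
        using that u by (intro stable_Im_dir_deriv st v) (auto simp: Z_def X_def add_nonneg_pos)
    qed
    from tendsto_upperbound[OF lim this] have "Im (dir_deriv m ts v (Z 0) * cnj (peval m ts (Z 0))) \<le> 0"
      by simp
    moreover have "dir_deriv m ts v (Z 0) = N (\<i> * of_real \<eta>)" by (simp add: Z_def N_def)
    moreover have "cnj (peval m ts (Z 0)) = A (- (\<i> * of_real \<eta>))"
      by (simp add: Z_def A_def X_def flip: peval_cnj)
    ultimately show ?thesis by (simp add: M_def)
  qed
  have lim: "((\<lambda>h. (M (0 + h) - M 0) / h) \<longlongrightarrow> of_real (N1 * peval m ts x - dir_deriv m ts v x * dir_deriv m ts u x)) (at 0)"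
    using dM by (simp add: DERIV_def)
  have "filterlim (\<lambda>\<eta>. \<i> * of_real \<eta>) (at 0) (at_right (0::real))"
    by (rule filterlim_atI) (auto intro!: tendsto_eq_intros eventually_at_right_less[THEN eventually_mono])
  from filterlim_compose[OF lim this]
  have lim: "((\<lambda>\<eta>. Re ((M (\<i> * of_real \<eta>) - M 0) / (\<i> * of_real \<eta>))) \<longlongrightarrow>
      N1 * peval m ts x - dir_deriv m ts v x * dir_deriv m ts u x) (at_right 0)"
    by (auto dest!: tendsto_Re)
  have M0: "Im (M 0) = 0" by (simp add: M_def A0 N0)
  have "\<forall>\<^sub>F \<eta> in at_right 0. Re ((M (\<i> * of_real \<eta>) - M 0) / (\<i> * of_real \<eta>)) \<le> 0"
  proof (rule eventually_at_right_less[THEN eventually_mono])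
    fix \<eta> :: real assume "0 < \<eta>"
    have "Re ((M (\<i> * of_real \<eta>) - M 0) / (\<i> * of_real \<eta>)) = Im (M (\<i> * of_real \<eta>)) / \<eta>"
      using \<open>0 < \<eta>\<close> M0 by (simp add: Re_divide power2_eq_square)
    then show "Re ((M (\<i> * of_real \<eta>) - M 0) / (\<i> * of_real \<eta>)) \<le> 0"
      using neg[OF \<open>0 < \<eta>\<close>] \<open>0 < \<eta>\<close> by (simp add: divide_nonpos_pos)
  qed
  from tendsto_upperbound[OF lim this] show ?thesis by (simp add: N1_def)
qed

text \<open>
  By the Rayleigh inequality the quotient has a nonpositive derivative along \<open>u\<close>.
\<close>

lemma log_derivative_antimono:
  fixes x :: "nat \<Rightarrow> real"
  assumes st: "stable m ts" and u: "\<And>i. i < m \<Longrightarrow> u i \<ge> 0" and v: "\<And>i. i < m \<Longrightarrow> v i \<ge> 0"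
    and pos: "\<And>r. 0 \<le> r \<Longrightarrow> r \<le> s \<Longrightarrow> peval m ts (\<lambda>i. x i + r * u i) > 0" and "s \<ge> 0"
  shows "dir_deriv m ts v (\<lambda>i. x i + s * u i) / peval m ts (\<lambda>i. x i + s * u i)
       \<le> dir_deriv m ts v x / peval m ts x"
proof -
  let ?p = "\<lambda>r. peval m ts (\<lambda>i. x i + r * u i)" and ?d = "\<lambda>r. dir_deriv m ts v (\<lambda>i. x i + r * u i)"
  have "?d s / ?p s \<le> ?d 0 / ?p 0"
  proof (rule DERIV_nonpos_imp_nonincreasing[OF \<open>s \<ge> 0\<close>], intro exI conjI)
    fix r assume r: "0 \<le> r" "r \<le> s"
    let ?y = "\<lambda>i. x i + r * u i"
    let ?n = "\<Sum>j<m. v j * dir_deriv m (partial j ts) u ?y"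
    have d1: "(?p has_field_derivative dir_deriv m ts u ?y) (at r)"
      using has_field_derivative_peval[of m ts x u r] by simp
    have d2: "(?d has_field_derivative ?n) (at r)"
      using has_field_derivative_dir_deriv[of m ts v x u r] by simp
    show "((\<lambda>r. ?d r / ?p r) has_field_derivative
        (?n * ?p r - ?d r * dir_deriv m ts u ?y) / (?p r * ?p r)) (at r)"
      by (rule DERIV_divide[OF d2 d1]) (use pos[OF r] in simp)
    show "(?n * ?p r - ?d r * dir_deriv m ts u ?y) / (?p r * ?p r) \<le> 0"
      using rayleigh[OF st u v, where x = ?y] pos[OF r]
      by (intro divide_nonpos_pos) auto
  qed
  then show ?thesis by simp
qed

text \<open>
  Log-concavity along nonnegative directions: the graph of \<open>ln p\<close> lies below its tangent.
\<close>

lemma peval_le_exp: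
  fixes x :: "nat \<Rightarrow> real"
  assumes st: "stable m ts" and u: "\<And>i. i < m \<Longrightarrow> u i \<ge> 0"
    and pos: "\<And>r. 0 \<le> r \<Longrightarrow> peval m ts (\<lambda>i. x i + r * u i) > 0" and "s \<ge> 0"
  shows "peval m ts (\<lambda>i. x i + s * u i) \<le> peval m ts x * exp (s * (dir_deriv m ts u x / peval m ts x))"
proof -
  let ?p = "\<lambda>r. peval m ts (\<lambda>i. x i + r * u i)" and ?d = "\<lambda>r. dir_deriv m ts u (\<lambda>i. x i + r * u i)"
  let ?a = "dir_deriv m ts u x / peval m ts x"
  have "ln (?p s) - s * ?a \<le> ln (?p 0) - 0 * ?a"
  proof (rule DERIV_nonpos_imp_nonincreasing[OF \<open>s \<ge> 0\<close>], intro exI conjI)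
    fix r assume r: "0 \<le> r" "r \<le> s"
    have d1: "(?p has_field_derivative ?d r) (at r)"
      using has_field_derivative_peval[of m ts x u r] by simp
    show "((\<lambda>r. ln (?p r) - r * ?a) has_field_derivative (?d r / ?p r - ?a)) (at r)"
      using pos[OF r(1)] pos[of 0] by (auto intro!: derivative_eq_intros d1)
    have "?d r / ?p r \<le> ?a"
      by (rule log_derivative_antimono[OF st u u pos]) (use r in auto)
    then show "?d r / ?p r - ?a \<le> 0" by simp
  qed
  then have "ln (?p s) \<le> ln (peval m ts x) + s * ?a" by simp
  then have "exp (ln (?p s)) \<le> exp (ln (peval m ts x) + s * ?a)" by simp
  then show ?thesis
    using pos[OF \<open>s \<ge> 0\<close>] pos[of 0] by (simp add: exp_add)
qed

section \<open>Stability of the linear coefficient in one variable\<close>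

text \<open>
  Hurwitz's theorem for a family that depends jointly continuously on a real parameter. The witness
  \<open>w'\<close> excludes the case of a limit that vanishes identically.
\<close>

lemma Hurwitz_param:
  fixes g :: "real \<Rightarrow> complex \<Rightarrow> complex"
  assumes S: "open S" "connected S" and hol: "\<And>r. g r holomorphic_on S"
    and cont: "continuous_on (UNIV \<times> S) (\<lambda>y. g (fst y) (snd y))"
    and lim: "\<sigma> \<longlonglongrightarrow> \<rho>" and nz: "\<And>n w. w \<in> S \<Longrightarrow> g (\<sigma> n) w \<noteq> 0"
    and w': "w' \<in> S" "g \<rho> w' \<noteq> 0" and w: "w \<in> S"
  shows "g \<rho> w \<noteq> 0"
proof (cases "g \<rho> constant_on S")
  case True
  then show ?thesis using w w' by (auto simp: constant_on_def)
next
  case False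
  show ?thesis
  proof (rule Hurwitz_no_zeros[of S "\<lambda>n. g (\<sigma> n)" "g \<rho>", OF S hol hol _ False _ w])
    fix K assume K: "compact K" "K \<subseteq> S"
    show "uniform_limit K (\<lambda>n. g (\<sigma> n)) (g \<rho>) sequentially"
    proof (rule uniform_limitI)
      fix e :: real assume "e > 0"
      have "continuous_on (UNIV \<times> K) (\<lambda>y. g (fst y) (snd y))"
        using K by (intro continuous_on_subset[OF cont]) auto
      from continuous_on_prod_compactE[OF this K(1) UNIV_I half_gt_zero[OF \<open>e > 0\<close>], of \<rho>]
      obtain X0 where X0': "\<rho> \<in> X0" "open X0"
        "\<forall>x\<in>X0 \<inter> UNIV. \<forall>t\<in>K. dist (g (fst (x, t)) (snd (x, t))) (g (fst (\<rho>, t)) (snd (\<rho>, t))) \<le> e / 2"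
        by blast
      then have X0: "\<rho> \<in> X0" "open X0" "\<And>x t. x \<in> X0 \<Longrightarrow> t \<in> K \<Longrightarrow> dist (g x t) (g \<rho> t) \<le> e / 2"
        by simp_all
      have "\<forall>\<^sub>F n in sequentially. \<sigma> n \<in> X0"
        by (rule topological_tendstoD[OF lim X0(2,1)])
      then show "\<forall>\<^sub>F n in sequentially. \<forall>x\<in>K. dist (g (\<sigma> n) x) (g \<rho> x) < e"
      proof eventually_elim
        fix n assume "\<sigma> n \<in> X0"
        show "\<forall>x\<in>K. dist (g (\<sigma> n) x) (g \<rho> x) < e"
        proof
          fix x assume "x \<in> K"
          from X0(3)[OF \<open>\<sigma> n \<in> X0\<close> this] \<open>e > 0\<close> show "dist (g (\<sigma> n) x) (g \<rho> x) < e" by linarith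
        qed
      qed
    qed
  qed (rule nz)
qed

text \<open>
  The coefficient of the first power of variable \<open>k\<close>, as a polynomial in the variables below \<open>k\<close>
  (the exponent of variable \<open>k\<close> stays in the terms but is ignored by \<open>peval k\<close>).
\<close>

definition linear_coeff :: "nat \<Rightarrow> terms \<Rightarrow> terms" where
  "linear_coeff k ts = filter (\<lambda>(c, e). e k = 1) ts"

lemma linear_coeff_simps [simp]: "linear_coeff k [] = []"
  "linear_coeff k ((c, e) # ts) = (if e k = 1 then (c, e) # linear_coeff k ts else linear_coeff k ts)"
  by (simp_all add: linear_coeff_def)

text \<open>
  The linear coefficient is the partial derivative at \<open>x\<^sub>k = 0\<close>.
\<close>

lemma peval_linear_coeff: "peval k (linear_coeff k ts) x = peval (Suc k) (partial k ts) (x(k := 0))"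
proof (induction ts)
  case (Cons ce ts)
  obtain c e where [simp]: "ce = (c, e)" by force
  have "(\<Prod>i<k. (x(k := 0)) i ^ (e(k := e k - 1)) i) = (\<Prod>i<k. x i ^ e i)"
    by (intro prod.cong) auto
  then show ?case
    using Cons by (cases "e k = 0"; cases "e k = 1") auto
qed simp

lemma dir_deriv_unit: "dir_deriv (Suc k) ts (\<lambda>i. if i = k then 1 else 0) x = peval (Suc k) (partial k ts) x"
  by (simp add: dir_deriv_def)

lemma homog_linear_coeff: "homog (Suc k) (Suc d) ts \<Longrightarrow> homog k d (linear_coeff k ts)"
  by (auto simp: homog_def linear_coeff_def)

lemma nonneg_linear_coeff: "nonneg ts \<Longrightarrow> nonneg (linear_coeff k ts)"
  by (auto simp: nonneg_def linear_coeff_def)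

lemma holomorphic_on_peval:
  "(\<lambda>w. peval m ts (\<lambda>i. a i + w * b i)) holomorphic_on (S :: complex set)"
proof -
  obtain P :: "complex poly" where "\<And>t. poly P t = peval m ts (\<lambda>i. a i + t * b i)"
    using peval_line_poly by metis
  then have "(\<lambda>w. peval m ts (\<lambda>i. a i + w * b i)) = poly P" by auto
  then show ?thesis by (simp add: holomorphic_intros)
qed

text \<open>
  The derivative in variable \<open>k\<close> at \<open>x\<^sub>k = 0\<close> is a limit of the functions
  \<open>\<partial>\<^sub>k p - \<i> r p\<close> at \<open>x\<^sub>k = \<i> r\<close> as \<open>r\<close> tends to \<open>0\<close>. These have no zeros because \<open>\<partial>\<^sub>k p / p\<close> lies in the closed
  lower half-plane and \<open>\<i> r\<close> in the open upper one. The second summand is needed since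
  \<open>\<partial>\<^sub>k p\<close> itself vanishes wherever \<open>p\<close> does not depend on \<open>x\<^sub>k\<close>.
\<close>

lemma stable_linear_coeff:
  assumes st: "stable (Suc k) ts" and hom: "homog k d (linear_coeff k ts)"
    and nz: "peval k (linear_coeff k ts) (\<lambda>_. 1) \<noteq> (0::real)"
  shows "stable k (linear_coeff k ts)"
  unfolding stable_def
proof (intro allI impI)
  fix z :: "nat \<Rightarrow> complex" assume z: "\<forall>i<k. Im (z i) > 0"
  \<comment> \<open>In the first \<open>k\<close> coordinates \<open>w\<close> moves from \<open>\<i>\<close>, where the limit is known to be nonzero, to \<open>z\<close>.\<close>
  define Z where "Z = (\<lambda>r w i. (if i < k then \<i> else \<i> * of_real r) + w * (if i < k then z i - \<i> else 0))"
  define g where "g = (\<lambda>r w. peval (Suc k) (partial k ts) (Z r w) - \<i> * of_real r * peval (Suc k) ts (Z r w))"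
  define S where "S = (\<Inter>i\<in>{..<k}. {w. Im (\<i> + w * (z i - \<i>)) > 0})"
  have g0: "g 0 w = peval k (linear_coeff k ts) (\<lambda>i. \<i> + w * (z i - \<i>))" for w
    unfolding g_def peval_linear_coeff by (auto simp: Z_def intro!: peval_cong)
  have "g 0 1 \<noteq> 0"
  proof (rule Hurwitz_param[of S g "\<lambda>n. inverse (real (Suc n))" 0 0 1])
    show "open S" unfolding S_def
      by (intro open_INT ballI open_Collect_less continuous_intros) auto
    have "convex {w. Im (\<i> + w * (z i - \<i>)) > 0}" for i
    proof (rule convexI)
      fix x y :: complex and u v :: real
      assume *: "x \<in> {w. Im (\<i> + w * (z i - \<i>)) > 0}" "y \<in> {w. Im (\<i> + w * (z i - \<i>)) > 0}"
        "0 \<le> u" "0 \<le> v" "u + v = 1"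
      have "Im (\<i> + (u *\<^sub>R x + v *\<^sub>R y) * (z i - \<i>)) =
          u * Im (\<i> + x * (z i - \<i>)) + v * Im (\<i> + y * (z i - \<i>)) + (1 - (u + v))"
        by (simp add: algebra_simps)
      also have "\<dots> > 0"
      proof (cases "u = 0")
        case True
        then show ?thesis using * by simp
      next
        case False
        then have "u * Im (\<i> + x * (z i - \<i>)) > 0" using * by simp
        moreover have "v * Im (\<i> + y * (z i - \<i>)) \<ge> 0" using * by (intro mult_nonneg_nonneg) auto
        ultimately show ?thesis using * by linarith
      qed
      finally show "u *\<^sub>R x + v *\<^sub>R y \<in> {w. Im (\<i> + w * (z i - \<i>)) > 0}" by simp
    qed
    then show "connected S" unfolding S_def by (intro convex_connected convex_INT)
    show "g r holomorphic_on S" for r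
      unfolding g_def Z_def by (intro holomorphic_intros holomorphic_on_peval)
    show "continuous_on (UNIV \<times> S) (\<lambda>y. g (fst y) (snd y))"
    proof -
      have "continuous_on (UNIV \<times> S) (\<lambda>y. Z (fst y) (snd y) i)" for i
        unfolding Z_def by (cases "i < k"; simp; intro continuous_intros)
      then show ?thesis
        unfolding g_def by (intro continuous_intros continuous_on_peval)
    qed
    show "(\<lambda>n. inverse (real (Suc n))) \<longlonglongrightarrow> 0"
      by (rule LIMSEQ_inverse_real_of_nat)
    show "g (inverse (real (Suc n))) w \<noteq> 0" if w: "w \<in> S" for n w
    proof
      define r where "r = inverse (real (Suc n))"
      have "r > 0" by (simp add: r_def)
      assume "g (inverse (real (Suc n))) w = 0"
      then have eq: "peval (Suc k) (partial k ts) (Z r w) = \<i> * of_real r * peval (Suc k) ts (Z r w)"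
        by (simp add: g_def r_def)
      have pos: "Im (Z r w i) > 0" if "i < Suc k" for i
        using w that \<open>r > 0\<close> by (auto simp: Z_def S_def less_Suc_eq)
      then have "peval (Suc k) ts (Z r w) \<noteq> 0" using st by (auto simp: stable_def)
      have "Im (dir_deriv (Suc k) ts (\<lambda>i. if i = k then 1 else 0) (Z r w) * cnj (peval (Suc k) ts (Z r w))) \<le> 0"
        by (rule stable_Im_dir_deriv[OF st pos]) auto
      then have "Im (\<i> * of_real r * (peval (Suc k) ts (Z r w) * cnj (peval (Suc k) ts (Z r w)))) \<le> 0"
        by (simp only: dir_deriv_unit eq mult.assoc)
      then have "r * (cmod (peval (Suc k) ts (Z r w)))\<^sup>2 \<le> 0"
        by (simp only: complex_norm_square[symmetric]) simp
      with \<open>r > 0\<close> \<open>peval (Suc k) ts (Z r w) \<noteq> 0\<close> show False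
        by (simp add: mult_le_0_iff)
    qed
    show "0 \<in> S" "1 \<in> S" using z by (auto simp: S_def)
    have "g 0 0 = peval k (linear_coeff k ts) (\<lambda>i. \<i> * of_real 1)" by (simp add: g0)
    also have "\<dots> = \<i> ^ d * of_real (peval k (linear_coeff k ts) (\<lambda>_. 1))"
      by (simp only: peval_homog[OF hom] peval_of_real)
    finally show "g 0 0 \<noteq> 0" using nz by simp
  qed
  then show "peval k (linear_coeff k ts) z \<noteq> 0" by (simp add: g0)
qed

definition multilinear_coeff :: "nat \<Rightarrow> terms \<Rightarrow> real" where
  "multilinear_coeff m ts = (\<Sum>(c, e)\<leftarrow>ts. if \<forall>i<m. e i = 1 then c else 0)"

lemma multilinear_coeff_linear_coeff: "multilinear_coeff (Suc k) ts = multilinear_coeff k (linear_coeff k ts)"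
  unfolding multilinear_coeff_def by (induction ts) (auto simp: less_Suc_eq)

section \<open>Capacity and the multilinear coefficient\<close>

text \<open>
  Let \<open>R\<close> be the polynomial as a function of the last variable alone. Log-concavity gives
  \<open>R (\<delta> + s) \<le> R \<delta> exp (s R' \<delta> / R \<delta>)\<close>, and the choice \<open>s = R \<delta> / R' \<delta>\<close> turns the bound
  \<open>C X s \<le> R (\<delta> + s)\<close> into \<open>C X \<le> e R' \<delta>\<close>. The limit \<open>\<delta> \<rightarrow> 0\<close> is taken last because \<open>R 0\<close> may vanish.
\<close>

lemma capacity_linear_coeff:
  fixes C :: real and x :: "nat \<Rightarrow> real"
  assumes nn: "nonneg ts" and st: "stable (Suc k) ts" and "C > 0"
    and cap: "\<And>x. (\<And>i. i < Suc k \<Longrightarrow> x i > 0) \<Longrightarrow> C * (\<Prod>i<Suc k. x i) \<le> peval (Suc k) ts x"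
    and x: "\<And>i. i < k \<Longrightarrow> x i > 0"
  shows "C * (\<Prod>i<k. x i) \<le> exp 1 * peval k (linear_coeff k ts) x"
proof -
  define R where "R = (\<lambda>t. peval (Suc k) ts (x(k := t)))"
  define D where "D = (\<lambda>t. peval (Suc k) (partial k ts) (x(k := t)))"
  define X where "X = (\<Prod>i<k. x i)"
  have X: "X > 0" unfolding X_def using x by (intro prod_pos) auto
  have Rcap: "C * X * t \<le> R t" if "t > 0" for t
  proof -
    have "(x(k := t)) i > 0" if "i < Suc k" for i
      using x[of i] that \<open>t > 0\<close> by (cases "i = k") simp_all
    from cap[of "x(k := t)", OF this] show ?thesis by (simp add: X_def R_def mult.assoc)
  qed
  have Rpos: "R t > 0" if "t > 0" for t
    by (rule less_le_trans[OF _ Rcap[OF that]]) (use X \<open>C > 0\<close> that in simp)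
  have Dnn: "D t \<ge> 0" if "t \<ge> 0" for t
    unfolding D_def using x that
    by (intro peval_nonneg nonneg_partial nn) (auto simp: less_Suc_eq intro: less_imp_le)
  have le: "R (\<delta> + s) \<le> R \<delta> * exp (s * (D \<delta> / R \<delta>))" if "\<delta> > 0" "s \<ge> 0" for \<delta> s
  proof -
    let ?u = "\<lambda>i. if i = k then 1 else (0::real)"
    have eq: "(\<lambda>i. (x(k := \<delta>)) i + r * ?u i) = x(k := \<delta> + r)" for r by auto
    have "peval (Suc k) ts (\<lambda>i. (x(k := \<delta>)) i + s * ?u i) \<le> peval (Suc k) ts (x(k := \<delta>)) *
        exp (s * (dir_deriv (Suc k) ts ?u (x(k := \<delta>)) / peval (Suc k) ts (x(k := \<delta>))))"
    proof (rule peval_le_exp[OF st])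
      show "peval (Suc k) ts (\<lambda>i. (x(k := \<delta>)) i + r * ?u i) > 0" if "0 \<le> r" for r
        using Rpos[of "\<delta> + r"] that \<open>\<delta> > 0\<close> by (simp only: eq R_def)
    qed (use that in auto)
    then show ?thesis by (simp only: eq dir_deriv_unit R_def D_def)
  qed
  have main: "C * X \<le> exp 1 * D \<delta>" if "\<delta> > 0" for \<delta>
  proof -
    have "D \<delta> \<noteq> 0"
    proof
      assume "D \<delta> = 0"
      define s where "s = R \<delta> / (C * X)"
      have "s \<ge> 0" using Rpos[OF that] X \<open>C > 0\<close> by (simp add: s_def)
      have CX: "C * X > 0" using X \<open>C > 0\<close> by simp
      have "C * X * (\<delta> + s) \<le> R (\<delta> + s)"
        using that \<open>s \<ge> 0\<close> by (intro Rcap) linarith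
      also have "\<dots> \<le> R \<delta> * exp (s * (D \<delta> / R \<delta>))"
        by (rule le[OF that \<open>s \<ge> 0\<close>])
      also have "\<dots> = R \<delta>" by (simp only: \<open>D \<delta> = 0\<close>) simp
      also have "R \<delta> = C * X * s" using X \<open>C > 0\<close> by (simp add: s_def)
      finally have "C * X * \<delta> \<le> 0" by (simp only: distrib_left)
      moreover have "C * X * \<delta> > 0" using CX that by (rule mult_pos_pos)
      ultimately show False by simp
    qed
    then have D: "D \<delta> > 0" using Dnn[of \<delta>] that by simp
    define s where "s = R \<delta> / D \<delta>"
    have s: "s > 0" using Rpos[OF that] D by (simp add: s_def)
    have "C * X * s \<le> C * X * (\<delta> + s)"
      using X \<open>C > 0\<close> that by (intro mult_left_mono) auto
    also have "\<dots> \<le> R (\<delta> + s)" using that s by (intro Rcap) auto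
    also have "\<dots> \<le> R \<delta> * exp (s * (D \<delta> / R \<delta>))" using that s by (intro le) auto
    also have "s * (D \<delta> / R \<delta>) = 1" using D Rpos[OF that] by (simp add: s_def)
    finally have *: "C * X * s \<le> R \<delta> * exp 1" .
    have "R \<delta> = s * D \<delta>" using D by (simp add: s_def)
    with * have "s * (C * X) \<le> s * (exp 1 * D \<delta>)" by (simp only: mult_ac)
    then show ?thesis using s by (simp only: mult_le_cancel_left_pos)
  qed
  have "(D \<longlongrightarrow> D 0) (at_right 0)"
    unfolding D_def by (intro tendsto_peval) (auto intro!: tendsto_intros)
  then have "((\<lambda>\<delta>. exp 1 * D \<delta>) \<longlongrightarrow> exp 1 * D 0) (at_right 0)"
    by (intro tendsto_intros)
  moreover have "\<forall>\<^sub>F \<delta> in at_right 0. C * X \<le> exp 1 * D \<delta>"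
    by (rule eventually_at_right_less[THEN eventually_mono]) (use main in auto)
  ultimately have "C * X \<le> exp 1 * D 0"
    by (rule tendsto_lowerbound) simp
  then show ?thesis by (simp add: X_def D_def peval_linear_coeff)
qed

text \<open>
  Elimination of one variable after the other. The last one costs no factor \<open>e\<close>, because a
  homogeneous polynomial of degree one in one variable equals its linear coefficient times the variable.
\<close>

lemma capacity_le_multilinear_coeff:
  fixes C :: real
  assumes "nonneg ts" "homog (Suc m) (Suc m) ts" "stable (Suc m) ts" "C > 0"
    and "\<And>x. (\<And>i. i < Suc m \<Longrightarrow> x i > 0) \<Longrightarrow> C * (\<Prod>i<Suc m. x i) \<le> peval (Suc m) ts x"
  shows "C \<le> exp 1 ^ m * multilinear_coeff (Suc m) ts"
  using assms
proof (induction m arbitrary: ts C)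
  case 0
  have "peval 1 ts (\<lambda>_. 1) = multilinear_coeff (Suc 0) ts"
    using 0(2) by (induction ts) (auto simp: homog_def multilinear_coeff_def)
  then show ?case using 0(5)[of "\<lambda>_. 1"] by simp
next
  case (Suc m)
  let ?ts = "linear_coeff (Suc m) ts"
  have nn: "nonneg ?ts" and hom: "homog (Suc m) (Suc m) ?ts"
    using Suc.prems by (auto intro: nonneg_linear_coeff homog_linear_coeff)
  have cap: "(C / exp 1) * (\<Prod>i<Suc m. x i) \<le> peval (Suc m) ?ts x" if "\<And>i. i < Suc m \<Longrightarrow> x i > 0" for x
    using capacity_linear_coeff[OF Suc.prems(1,3,4,5) that] by (simp add: field_simps)
  have C: "C / exp 1 > 0" using Suc.prems by simp
  have "peval (Suc m) ?ts (\<lambda>_. 1) > (0::real)"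
    by (rule less_le_trans[OF _ cap]) (use C in auto)
  then have "stable (Suc m) ?ts"
    by (intro stable_linear_coeff[OF Suc.prems(3) hom]) auto
  from Suc.IH[OF nn hom this C cap] have "C / exp 1 \<le> exp 1 ^ m * multilinear_coeff (Suc m) ?ts" .
  then show ?case by (simp add: multilinear_coeff_linear_coeff[of "Suc m"] field_simps)
qed

section \<open>Hyperbolicity implies stability\<close>

text \<open>
  Garding's deformation argument. For positive \<open>b\<close> and real \<open>a\<close> let \<open>P s t = p(\<i> 1 + s a + t b)\<close>. It has no real
  zero \<open>t\<close>, because \<open>p\<close> is real-rooted in direction \<open>1\<close>. For \<open>s = 0\<close> the zeros are \<open>-\<i> / \<lambda>\<close> with \<open>\<lambda> > 0\<close> a root
  of \<open>b\<close>, so they lie in the lower half-plane, and no zero can cross the real line as \<open>s\<close> grows from \<open>0\<close> to \<open>1\<close>.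
  Stability is the case \<open>s = 1\<close>, \<open>t = \<i>\<close>, since each point with imaginary part \<open>> 0\<close> is a multiple of some
  \<open>\<i> (1 + b) + a\<close>.
\<close>

lemma real_rooted_imp_stable:
  fixes ts :: terms
  assumes hom: "homog n n ts" and nn: "nonneg ts" and p1: "peval n ts (\<lambda>_. 1) > (0::real)"
    and real: "\<And>(x :: nat \<Rightarrow> real) z :: complex. peval n ts (\<lambda>i. of_real (x i) - z) = 0 \<Longrightarrow> Im z = 0"
    and nonneg: "\<And>(x :: nat \<Rightarrow> real) z :: complex. (\<And>i. i < n \<Longrightarrow> x i \<ge> 0) \<Longrightarrow>
        peval n ts (\<lambda>i. of_real (x i) - z) = 0 \<Longrightarrow> Re z \<ge> 0"
  shows "stable n ts"
proof -
  have key: "peval n ts (\<lambda>i. \<i> + \<i> * of_real (b i) + of_real (a i)) \<noteq> 0"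
    if b: "\<And>i. i < n \<Longrightarrow> b i > 0" for a b :: "nat \<Rightarrow> real"
  proof -
    define P where "P = (\<lambda>s t. peval n ts (\<lambda>i. (\<i> + of_real s * of_real (a i)) + t * of_real (b i)))"
    have pb: "peval n ts b > 0" using peval_pos[OF nn p1] b by auto
    have real': "Im t \<noteq> 0" if "P s t = 0" for s t
    proof
      assume "Im t = 0"
      then have "t = of_real (Re t)" by (simp add: complex_eq_iff)
      then have "P s t = peval n ts (\<lambda>i. of_real (Re t * b i + s * a i) - (- \<i>))"
        unfolding P_def by (intro peval_cong) (simp add: algebra_simps)
      with that real[of "\<lambda>i. Re t * b i + s * a i" "- \<i>"] show False by simp
    qed
    have zero: "Im t < 0" if "P 0 t = 0" for t
    proof -
      have "t \<noteq> 0" using real'[OF that] by auto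
      have "P 0 t = peval n ts (\<lambda>i. t * (of_real (b i) - (- \<i> / t)))"
        unfolding P_def using \<open>t \<noteq> 0\<close> by (intro peval_cong) (simp add: algebra_simps)
      then have *: "peval n ts (\<lambda>i. of_real (b i) - (- \<i> / t)) = 0"
        using that \<open>t \<noteq> 0\<close> by (simp add: peval_homog[OF hom])
      have "Im (- \<i> / t) = 0" "Re (- \<i> / t) \<ge> 0"
        using real[OF *] nonneg[OF _ *] b by (auto intro: less_imp_le)
      then obtain r where r: "- \<i> / t = of_real r" "r \<ge> 0" by (metis complex_eq_iff Re_complex_of_real Im_complex_of_real)
      then have "r > 0" using \<open>t \<noteq> 0\<close> by (cases "r = 0") auto
      moreover have "t = - \<i> / of_real r" using r \<open>t \<noteq> 0\<close> \<open>r > 0\<close> by (auto simp: field_simps)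
      ultimately show ?thesis by (simp add: Im_divide power2_eq_square)
    qed
    \<comment> \<open>The leading coefficient \<open>p(b)\<close> in \<open>t\<close> is constant and nonzero, so zeros cannot escape to infinity.\<close>
    have bound: "\<exists>C>0. \<forall>s t. 0 \<le> s \<longrightarrow> s \<le> 1 \<longrightarrow> P s t = 0 \<longrightarrow> cmod t \<le> C"
    proof -
      define h where "h = (\<lambda>y. peval n ts (\<lambda>i. of_real (b i) + fst y * \<i> + snd y * of_real (a i)))"
      have "(h \<longlongrightarrow> h (0, 0)) (nhds (0, 0))"
        unfolding h_def by (intro tendsto_peval tendsto_intros) (auto intro!: tendsto_eq_intros filterlim_ident)
      moreover have "h (0, 0) \<noteq> 0" using pb by (simp add: h_def peval_of_real)
      ultimately have "\<forall>\<^sub>F y in nhds (0, 0). h y \<noteq> 0" by (rule tendsto_imp_eventually_ne)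
      then obtain d where d: "d > 0" "\<And>y. dist y (0, 0) < d \<Longrightarrow> h y \<noteq> 0"
        unfolding eventually_nhds_metric by blast
      show ?thesis
      proof (intro exI conjI allI impI)
        show "2 / d > 0" using d by simp
        fix s :: real and t assume s: "0 \<le> s" "s \<le> 1" and "P s t = 0"
        show "cmod t \<le> 2 / d"
        proof (rule ccontr)
          assume "\<not> cmod t \<le> 2 / d"
          then have t: "cmod t > 2 / d" by simp
          then have "t \<noteq> 0" using d(1) by auto
          have lt: "1 / cmod t < d / 2" using t d(1) \<open>t \<noteq> 0\<close> by (simp add: field_simps)
          have "dist (1 / t, of_real s / t) (0, 0) \<le> cmod (1 / t) + cmod (of_real s / t)"
            unfolding dist_norm by (simp add: norm_Pair sqrt_sum_squares_le_sum)
          also have "\<dots> \<le> 1 / cmod t + 1 / cmod t"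
            using s by (intro add_mono) (auto simp: norm_divide intro!: divide_right_mono)
          also have "\<dots> < d" using lt by simp
          finally have "h (1 / t, of_real s / t) \<noteq> 0" by (rule d(2))
          moreover have "P s t = peval n ts (\<lambda>i. t * (of_real (b i) + (1 / t) * \<i> + (of_real s / t) * of_real (a i)))"
            unfolding P_def using \<open>t \<noteq> 0\<close> by (intro peval_cong) (simp add: algebra_simps)
          then have "P s t = t ^ n * h (1 / t, of_real s / t)"
            by (simp only: peval_homog[OF hom] h_def fst_conv snd_conv)
          ultimately show False using \<open>P s t = 0\<close> \<open>t \<noteq> 0\<close> by simp
        qed
      qed
    qed
    then obtain C where C: "C > 0" "\<And>s t. 0 \<le> s \<Longrightarrow> s \<le> 1 \<Longrightarrow> P s t = 0 \<Longrightarrow> cmod t \<le> C" by blast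
    have contP: "continuous_on S (\<lambda>y. P (fst y) (snd y))" for S
      unfolding P_def by (intro continuous_on_peval continuous_intros)
    \<comment> \<open>The parameters with and without a zero in the closed upper half-plane form two closed sets, by
      compactness and by Hurwitz's theorem. They are disjoint and cover the unit interval.\<close>
    define K where "K = ({0..1} \<times> (cball 0 C \<inter> {t. Im t \<ge> 0})) \<inter> (\<lambda>y. P (fst y) (snd y)) -` {0}"
    have "compact K" unfolding K_def
    proof (rule closed_Int_compact[THEN back_subst[of compact, OF _ Int_commute]])
      show "closed ((\<lambda>y. P (fst y) (snd y)) -` {0})"
        by (intro closed_vimage contP) simp
      show "compact ({0..1::real} \<times> (cball 0 C \<inter> {t. Im t \<ge> 0}))"
        by (intro compact_Times compact_Int_closed closed_halfspace_Im_ge compact_Icc compact_cball)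
    qed
    then have A: "closed (fst ` K)"
      by (intro compact_imp_closed compact_continuous_image continuous_intros)
    define G where "G = {s \<in> {0..1}. \<forall>t. Im t > 0 \<longrightarrow> P s t \<noteq> 0}"
    have G: "closed G"
    proof (unfold closed_sequential_limits, intro allI impI, elim conjE)
      fix \<sigma> s assume \<sigma>: "\<forall>k. \<sigma> k \<in> G" "\<sigma> \<longlonglongrightarrow> s"
      have "closed {0..1::real}" by simp
      with \<sigma> have s: "s \<in> {0..1}" unfolding closed_sequential_limits G_def by blast
      moreover have "P s t \<noteq> 0" if "Im t > 0" for t
      proof (rule Hurwitz_param[where g = P and S = "{t. Im t > 0}" and \<sigma> = \<sigma> and \<rho> = s and w' = "\<i> * of_real (C + 1)"])
        show "open {t. 0 < Im t}" by (rule open_halfspace_Im_gt)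
        show "connected {t. 0 < Im t}" by (intro convex_connected convex_halfspace_Im_gt)
        show "P r holomorphic_on {t. 0 < Im t}" for r unfolding P_def by (rule holomorphic_on_peval)
        show "continuous_on (UNIV \<times> {t. 0 < Im t}) (\<lambda>y. P (fst y) (snd y))" by (rule contP)
        show "P s (\<i> * of_real (C + 1)) \<noteq> 0"
          using C(2)[of s "\<i> * of_real (C + 1)"] C(1) s by (auto simp: norm_mult simp del: of_real_add)
        show "P (\<sigma> k) w \<noteq> 0" if "w \<in> {t. 0 < Im t}" for k w
          using \<sigma>(1) that by (simp add: G_def)
        show "\<i> * of_real (C + 1) \<in> {t. 0 < Im t}" using C(1) by simp
        show "t \<in> {t. 0 < Im t}" using that by simp
      qed (rule \<sigma>(2))
      ultimately show "s \<in> G" by (simp add: G_def)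
    qed
    have KG: "s \<in> fst ` K \<longleftrightarrow> s \<notin> G" if s: "s \<in> {0..1}" for s
    proof
      assume "s \<in> fst ` K"
      then obtain t where t: "Im t \<ge> 0" "P s t = 0" by (auto simp: K_def)
      then have "Im t > 0" using real'[OF t(2)] by linarith
      with t(2) show "s \<notin> G" by (auto simp: G_def)
    next
      assume "s \<notin> G"
      then obtain t where t: "Im t > 0" "P s t = 0" using s by (auto simp: G_def)
      then have "(s, t) \<in> K" using C(2)[of s t] s by (auto simp: K_def)
      then show "s \<in> fst ` K" by force
    qed
    have "P 0 t \<noteq> 0" if "Im t > 0" for t using zero[of t] that by linarith
    then have "0 \<in> G" by (simp add: G_def)
    have "1 \<in> G"
    proof (rule ccontr)
      assume "1 \<notin> G"
      have "fst ` K \<inter> G \<inter> {0..1} = {}" by (rule equals0I) (metis IntE KG)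
      moreover have "{0..1} \<subseteq> fst ` K \<union> G" by (rule subsetI) (metis UnCI KG)
      ultimately have "fst ` K \<inter> {0..1} = {} \<or> G \<inter> {0..1} = {}"
        by (intro connected_closedD A G) simp_all
      moreover have "1 \<in> fst ` K \<inter> {0..1}" using KG[of 1] \<open>1 \<notin> G\<close> by simp
      moreover have "0 \<in> G \<inter> {0..1}" using \<open>0 \<in> G\<close> by simp
      ultimately show False by (metis empty_iff)
    qed
    then have "P 1 \<i> \<noteq> 0" by (simp add: G_def)
    then show ?thesis by (simp add: P_def algebra_simps)
  qed
  show ?thesis unfolding stable_def
  proof (intro allI impI)
    fix z :: "nat \<Rightarrow> complex" assume z: "\<forall>i<n. Im (z i) > 0"
    \<comment> \<open>The \<open>1\<close> covers the case \<open>n = 0\<close>.\<close>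
    define \<epsilon> where "\<epsilon> = Min (insert 1 ((\<lambda>i. Im (z i)) ` {..<n})) / 2"
    have m: "Min (insert 1 ((\<lambda>i. Im (z i)) ` {..<n})) > 0" using z by (subst Min_gr_iff) auto
    have \<epsilon>: "\<epsilon> > 0" using m by (simp add: \<epsilon>_def)
    have lt: "\<epsilon> < Im (z i)" if "i < n" for i
    proof -
      have "Min (insert 1 ((\<lambda>i. Im (z i)) ` {..<n})) \<le> Im (z i)" using that by (intro Min_le) auto
      then show ?thesis using m unfolding \<epsilon>_def by linarith
    qed
    have "peval n ts z = peval n ts (\<lambda>i. of_real \<epsilon> *
        (\<i> + \<i> * of_real ((Im (z i) - \<epsilon>) / \<epsilon>) + of_real (Re (z i) / \<epsilon>)))"
      using \<epsilon> by (intro peval_cong) (auto simp: complex_eq_iff field_simps)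
    also have "\<dots> = of_real \<epsilon> ^ n * peval n ts (\<lambda>i. \<i> + \<i> * of_real ((Im (z i) - \<epsilon>) / \<epsilon>) + of_real (Re (z i) / \<epsilon>))"
      by (rule peval_homog[OF hom])
    also have "\<dots> \<noteq> 0"
      using key[of "\<lambda>i. (Im (z i) - \<epsilon>) / \<epsilon>" "\<lambda>i. Re (z i) / \<epsilon>"] \<epsilon> lt by simp
    finally show "peval n ts z \<noteq> 0" .
  qed
qed

text \<open>
  The cofactor \<open>R\<close> is a constant exactly if the polynomial splits into linear factors; this is how
  a count of roots turns into a factorization.
\<close>

lemma proots_split:
  fixes Q :: "'a :: idom poly"
  assumes "Q \<noteq> 0"
  shows "\<exists>R. Q = (\<Prod>r\<in>#proots Q. [:-r, 1:]) * R"
  using assms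
proof (induction "size (proots Q)" arbitrary: Q)
  case (Suc k)
  then have "proots Q \<noteq> {#}" by auto
  then obtain r where r: "r \<in># proots Q" by auto
  then have "[:-r, 1:] dvd Q" using Suc.prems by (simp add: poly_eq_0_iff_dvd)
  then obtain Q' where Q': "Q = [:-r, 1:] * Q'" by (elim dvdE)
  then have "Q' \<noteq> 0" using Suc.prems by auto
  then have eq: "proots Q = add_mset r (proots Q')"
    unfolding Q' by (subst proots_mult) (auto simp del: mult_pCons_left)
  then obtain R where "Q' = (\<Prod>r\<in>#proots Q'. [:-r, 1:]) * R" using Suc.hyps \<open>Q' \<noteq> 0\<close> by force
  then have "Q = (\<Prod>r\<in>#proots Q. [:-r, 1:]) * R"
    unfolding eq by (subst Q') (simp add: mult.assoc del: mult_pCons_left)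
  then show ?case by blast
qed auto

definition terms_of :: "mpoly \<Rightarrow> terms" where
  "terms_of p = map (\<lambda>\<alpha>. (Poly_Mapping.lookup p \<alpha>, Poly_Mapping.lookup \<alpha>))
     (sorted_list_of_set (Poly_Mapping.keys p))"

lemma set_terms_of:
  "set (terms_of p) = (\<lambda>\<alpha>. (Poly_Mapping.lookup p \<alpha>, Poly_Mapping.lookup \<alpha>)) ` Poly_Mapping.keys p"
  by (simp add: terms_of_def)

lemma sum_list_terms_of:
  "(\<Sum>(c, e)\<leftarrow>terms_of p. f c e) =
     (\<Sum>\<alpha>\<in>Poly_Mapping.keys p. f (Poly_Mapping.lookup p \<alpha>) (Poly_Mapping.lookup \<alpha>))"
  by (simp add: terms_of_def o_def sum_list_distinct_conv_sum_set)

lemma prod_keys_lessThan: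
  fixes x :: "nat \<Rightarrow> 'a::comm_monoid_mult"
  assumes "Poly_Mapping.keys \<alpha> \<subseteq> {..<n}"
  shows "(\<Prod>i\<in>Poly_Mapping.keys \<alpha>. x i ^ Poly_Mapping.lookup \<alpha> i) = (\<Prod>i<n. x i ^ Poly_Mapping.lookup \<alpha> i)"
  using assms by (intro prod.mono_neutral_left) (auto simp: in_keys_iff)

lemma homog_terms_of:
  assumes "homogeneous n n p" shows "homog n n (terms_of p)"
proof -
  have "(\<Sum>i<n. Poly_Mapping.lookup \<alpha> i) = n" if "\<alpha> \<in> Poly_Mapping.keys p" for \<alpha>
  proof -
    have "(\<Sum>i\<in>Poly_Mapping.keys \<alpha>. Poly_Mapping.lookup \<alpha> i) = (\<Sum>i<n. Poly_Mapping.lookup \<alpha> i)"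
      using assms that by (intro sum.mono_neutral_left) (auto simp: homogeneous_def in_keys_iff)
    then show ?thesis using assms that by (simp add: homogeneous_def)
  qed
  then show ?thesis by (auto simp: homog_def set_terms_of)
qed

lemma nonneg_terms_of: "nonneg_int_coeffs p \<Longrightarrow> nonneg (terms_of p)"
  by (auto simp: nonneg_int_coeffs_def nonneg_def set_terms_of elim: Nats_cases)
     (metis Nats_cases of_nat_0_le_iff)

lemma mpoly_eval_terms_of:
  assumes "homogeneous n n p" shows "mpoly_eval p x = peval n (terms_of p) x"
  unfolding mpoly_eval_def mpoly_subst_def peval_def sum_list_terms_of
  using assms by (auto intro!: sum.cong simp: homogeneous_def prod_keys_lessThan)

lemma degree_line_poly:
  assumes "homogeneous n n p" shows "degree (line_poly p d x) \<le> n"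
  unfolding line_poly_def mpoly_subst_def
proof (rule degree_sum_le)
  fix \<alpha> assume \<alpha>: "\<alpha> \<in> Poly_Mapping.keys p"
  let ?f = "\<lambda>i. [:x i, - d i:] ^ Poly_Mapping.lookup \<alpha> i"
  have "degree ([:Poly_Mapping.lookup p \<alpha>:] * (\<Prod>i\<in>Poly_Mapping.keys \<alpha>. ?f i)) \<le>
      degree (\<Prod>i\<in>Poly_Mapping.keys \<alpha>. ?f i)"
    by simp
  also have "\<dots> \<le> (\<Sum>i\<in>Poly_Mapping.keys \<alpha>. degree (?f i))"
    by (metis (no_types, lifting) degree_prod_sum_le finite_keys comp_apply sum.cong)
  also have "\<dots> \<le> (\<Sum>i\<in>Poly_Mapping.keys \<alpha>. Poly_Mapping.lookup \<alpha> i)"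
  proof (rule sum_mono)
    fix i
    have "degree (?f i) \<le> degree [:x i, - d i:] * Poly_Mapping.lookup \<alpha> i" by (rule degree_power_le)
    also have "\<dots> \<le> 1 * Poly_Mapping.lookup \<alpha> i" by (intro mult_right_mono) auto
    finally show "degree (?f i) \<le> Poly_Mapping.lookup \<alpha> i" by simp
  qed
  also have "\<dots> = n" using assms \<alpha> by (simp add: homogeneous_def)
  finally show "degree ([:Poly_Mapping.lookup p \<alpha>:] * (\<Prod>i\<in>Poly_Mapping.keys \<alpha>. ?f i)) \<le> n" .
qed simp

lemma poly_prod_mset_linear:
  fixes f :: "'b \<Rightarrow> 'a::comm_ring_1"
  shows "poly (\<Prod>r\<in>#M. [:- f r, 1:]) t = (\<Prod>r\<in>#M. t - f r)"
  by (induction M) (auto simp: algebra_simps)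

lemma degree_prod_mset_linear:
  fixes M :: "'a::idom multiset"
  shows "degree (\<Prod>r\<in>#M. [:-r, 1:]) = size M \<and> (\<Prod>r\<in>#M. [:-r, 1:]) \<noteq> 0"
  by (induction M) (auto simp: degree_mult_eq simp del: mult_pCons_left)

text \<open>
  Both sides are polynomials in \<open>z\<close> that agree on the real line. Over the complex numbers there are
  thus no zeros besides the \<open>n\<close> real roots.
\<close>

lemma hyperbolic_complex_line:
  assumes hyp: "hyperbolic n n (\<lambda>_. 1) p" and n: "n \<ge> 1"
  shows "\<exists>c. c \<noteq> 0 \<and> (\<forall>z::complex. peval n (terms_of p) (\<lambda>i. of_real (x i) - z) =
     of_real c * (\<Prod>r\<in>#proots (line_poly p (\<lambda>_. 1) x). z - of_real r))"
proof -
  let ?Q = "line_poly p (\<lambda>_. 1) x"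
  let ?M = "proots ?Q"
  have hom: "homogeneous n n p" and size: "size ?M = n" using hyp by (auto simp: hyperbolic_def)
  have "?Q \<noteq> 0" using size n by auto
  then obtain R where R: "?Q = (\<Prod>r\<in>#?M. [:-r, 1:]) * R" using proots_split by blast
  then have "R \<noteq> 0" using \<open>?Q \<noteq> 0\<close> by auto
  have "degree ?Q = n + degree R"
    using degree_prod_mset_linear[of ?M] \<open>R \<noteq> 0\<close> size by (subst R) (simp add: degree_mult_eq)
  then have "degree R = 0" using degree_line_poly[OF hom, of "\<lambda>_. 1" x] by simp
  then obtain c where c: "R = [:c:]" by (metis degree_eq_zeroE)
  then have "c \<noteq> 0" using \<open>R \<noteq> 0\<close> by auto
  obtain P :: "complex poly" where P: "\<And>t. poly P t = peval n (terms_of p) (\<lambda>i. of_real (x i) + t * (- 1))"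
    using peval_line_poly[where z = "\<lambda>i. of_real (x i)" and w = "\<lambda>_. - 1"] by metis
  define P' :: "complex poly" where "P' = smult (of_real c) (\<Prod>r\<in>#?M. [:- of_real r, 1:])"
  have eq: "poly P (of_real t) = poly P' (of_real t)" for t :: real
  proof -
    have "poly P (of_real t) = peval n (terms_of p) (\<lambda>i. of_real (x i - t))" by (simp add: P)
    also have "\<dots> = of_real (mpoly_eval p (\<lambda>i. x i - t * 1))"
      by (simp only: peval_of_real mpoly_eval_terms_of[OF hom]) simp
    also have "mpoly_eval p (\<lambda>i. x i - t * 1) = poly ?Q t" by (simp only: poly_line_poly)
    also have "poly ?Q t = c * (\<Prod>r\<in>#?M. t - r)"
      by (subst R) (simp add: c poly_prod_mset_linear)
    also have "of_real \<dots> = poly P' (of_real t)"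
    proof -
      have "of_real (\<Prod>r\<in>#M. t - r) = (\<Prod>r\<in>#M. of_real t - of_real r :: complex)" for M :: "real multiset"
        by (induction M) auto
      then show ?thesis by (simp add: P'_def poly_prod_mset_linear)
    qed
    finally show ?thesis .
  qed
  have "P = P'"
  proof (rule ccontr)
    assume "P \<noteq> P'"
    then have "finite {z. poly (P - P') z = 0}" by (intro poly_roots_finite) simp
    moreover have "range complex_of_real \<subseteq> {z. poly (P - P') z = 0}" using eq by auto
    moreover have "infinite (range complex_of_real)"
      by (simp add: finite_image_iff inj_on_def infinite_UNIV_char_0)
    ultimately show False using finite_subset by blast
  qed
  then have "peval n (terms_of p) (\<lambda>i. of_real (x i) - z) =
     of_real c * (\<Prod>r\<in>#?M. z - of_real r)" for z :: complex
    using P[of z] by (simp add: P'_def poly_prod_mset_linear)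
  then show ?thesis using \<open>c \<noteq> 0\<close> by blast
qed

lemma P_hyperbolic_imp_stable:
  assumes hyp: "P_hyperbolic n p" and nn: "nonneg_int_coeffs p" and n: "n \<ge> 1"
  shows "stable n (terms_of p)"
proof (rule real_rooted_imp_stable)
  have h: "hyperbolic n n (\<lambda>_. 1) p" using hyp by (simp add: P_hyperbolic_def)
  then have hom: "homogeneous n n p" by (simp add: hyperbolic_def)
  show "homog n n (terms_of p)" "nonneg (terms_of p)"
    by (rule homog_terms_of[OF hom], rule nonneg_terms_of[OF nn])
  show "peval n (terms_of p) (\<lambda>_. 1) > (0::real)"
    using h by (simp add: hyperbolic_def flip: mpoly_eval_terms_of[OF hom])
  have root: "\<exists>r. z = of_real r \<and> r \<in># proots (line_poly p (\<lambda>_. 1) x)"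
    if "peval n (terms_of p) (\<lambda>i. of_real (x i) - z) = 0" for x and z :: complex
  proof -
    obtain c where c: "c \<noteq> 0" "peval n (terms_of p) (\<lambda>i. of_real (x i) - z) =
     of_real c * (\<Prod>r\<in>#proots (line_poly p (\<lambda>_. 1) x). z - of_real r)"
      using hyperbolic_complex_line[OF h n, of x] by blast
    then show ?thesis using that by auto
  qed
  show "Im z = 0" if "peval n (terms_of p) (\<lambda>i. of_real (x i) - z) = 0" for x and z :: complex
    using root[OF that] by auto
  show "Re z \<ge> 0" if x: "\<And>i. i < n \<Longrightarrow> x i \<ge> 0" and z: "peval n (terms_of p) (\<lambda>i. of_real (x i) - z) = 0"
    for x and z :: complex
  proof -
    let ?M = "proots (line_poly p (\<lambda>_. 1) x)" and ?L = "sorted_list_of_multiset (proots (line_poly p (\<lambda>_. 1) x))"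
    obtain r where r: "z = of_real r" "r \<in># ?M" using root[OF z] by blast
    have "size ?M = n" using h by (simp add: hyperbolic_def)
    then have len: "length ?L = n" by (metis mset_sorted_list_of_multiset size_mset)
    have "hyp_root p (\<lambda>_. 1) n x \<ge> 0"
      using hyp x by (auto simp: P_hyperbolic_def d_nonnegative_def)
    then have "?L ! 0 \<ge> 0" using len n by (simp add: hyp_root_def rev_nth)
    moreover have "r \<in> set ?L" using r by simp
    then obtain i where i: "i < length ?L" "?L ! i = r" by (metis in_set_conv_nth)
    moreover have "?L ! 0 \<le> ?L ! i"
      using i by (intro sorted_nth_mono sorted_sorted_list_of_multiset) auto
    ultimately show ?thesis using r by simp
  qed
qed

section \<open>Mean degrees and scaling a set of variables\<close>

text \<open>
  For fixed sum of the numbers \<open>q x\<close> in \<open>[0, 1]\<close> the product is log-concave in them, hence smallest at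
  a vertex, where all but one of them are \<open>0\<close> or \<open>1\<close>. The induction removes one factor at a time and compares
  the two piecewise linear right-hand sides.
\<close>

lemma prod_affine_ge:
  fixes u :: real
  assumes "u \<ge> 0" "\<And>x. x \<in># M \<Longrightarrow> 0 \<le> q x \<and> q x \<le> 1"
    and "real k + \<theta> \<le> (\<Sum>x\<in>#M. q x)" "0 \<le> \<theta>" "\<theta> \<le> 1"
  shows "(1 + u) ^ k * (1 + \<theta> * u) \<le> (\<Prod>x\<in>#M. 1 + q x * u)"
  using assms
proof (induction M arbitrary: k \<theta>)
  case empty
  then have "real k \<le> 0" "\<theta> = 0" by auto
  then show ?case by simp
next
  case (add x M)
  have x: "0 \<le> q x" "q x \<le> 1" using add.prems(2)[of x] by auto
  have M: "\<And>x. x \<in># M \<Longrightarrow> 0 \<le> q x \<and> q x \<le> 1" using add.prems(2) by auto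
  have pos: "(\<Prod>x\<in>#M. 1 + q x * u) \<ge> 0"
    using M \<open>u \<ge> 0\<close> by (induction M) (auto intro!: mult_nonneg_nonneg add_nonneg_nonneg)
  have u0: "0 \<le> 1 + q x * u" using x \<open>u \<ge> 0\<close> by simp
  show ?case
  proof (cases "q x \<le> \<theta>")
    case True
    have IH: "(1 + u) ^ k * (1 + (\<theta> - q x) * u) \<le> (\<Prod>x\<in>#M. 1 + q x * u)"
      using add.prems(3,5) True x by (intro add.IH \<open>u \<ge> 0\<close> M) auto
    have "1 + \<theta> * u \<le> (1 + (\<theta> - q x) * u) * (1 + q x * u)"
    proof -
      have "(1 + (\<theta> - q x) * u) * (1 + q x * u) = 1 + \<theta> * u + ((\<theta> - q x) * u) * (q x * u)"
        by (simp add: algebra_simps)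
      then show ?thesis using True x \<open>u \<ge> 0\<close> by simp
    qed
    then have "(1 + u) ^ k * (1 + \<theta> * u) \<le> (1 + u) ^ k * ((1 + (\<theta> - q x) * u) * (1 + q x * u))"
      using \<open>u \<ge> 0\<close> by (intro mult_left_mono) auto
    also have "\<dots> = ((1 + u) ^ k * (1 + (\<theta> - q x) * u)) * (1 + q x * u)" by (simp only: mult.assoc)
    also have "\<dots> \<le> (\<Prod>x\<in>#M. 1 + q x * u) * (1 + q x * u)"
      using IH u0 by (rule mult_right_mono)
    finally show ?thesis by (simp add: mult.commute)
  next
    case False
    show ?thesis
    proof (cases k)
      case 0
      have "(\<Prod>x\<in>#M. 1 + q x * u) \<ge> 1"
        using M
      proof (induction M)
        case (add y M)
        then have "1 * 1 \<le> (1 + q y * u) * (\<Prod>x\<in>#M. 1 + q x * u)"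
          using \<open>u \<ge> 0\<close> by (intro mult_mono) auto
        then show ?case by simp
      qed simp
      then have "(1 + q x * u) * 1 \<le> (1 + q x * u) * (\<Prod>x\<in>#M. 1 + q x * u)"
        using u0 by (rule mult_left_mono)
      moreover have "1 + \<theta> * u \<le> 1 + q x * u" using False \<open>u \<ge> 0\<close> by (simp add: mult_right_mono)
      ultimately show ?thesis using 0 by simp
    next
      case (Suc l)
      have IH: "(1 + u) ^ l * (1 + (1 + \<theta> - q x) * u) \<le> (\<Prod>x\<in>#M. 1 + q x * u)"
        using add.prems(3,4,5) False x Suc by (intro add.IH \<open>u \<ge> 0\<close> M) auto
      have "(1 + (1 + \<theta> - q x) * u) * (1 + q x * u) = (1 + u) * (1 + \<theta> * u) + (u * u) * ((1 - q x) * (q x - \<theta>))"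
        by (simp add: algebra_simps)
      moreover have "(u * u) * ((1 - q x) * (q x - \<theta>)) \<ge> 0"
        using x False \<open>u \<ge> 0\<close> by (intro mult_nonneg_nonneg) auto
      ultimately have "(1 + u) * (1 + \<theta> * u) \<le> (1 + (1 + \<theta> - q x) * u) * (1 + q x * u)" by linarith
      then have "(1 + u) ^ l * ((1 + u) * (1 + \<theta> * u)) \<le> (1 + u) ^ l * ((1 + (1 + \<theta> - q x) * u) * (1 + q x * u))"
        using \<open>u \<ge> 0\<close> by (intro mult_left_mono) auto
      also have "\<dots> = ((1 + u) ^ l * (1 + (1 + \<theta> - q x) * u)) * (1 + q x * u)" by (simp only: mult.assoc)
      also have "\<dots> \<le> (\<Prod>x\<in>#M. 1 + q x * u) * (1 + q x * u)"
        using IH u0 by (rule mult_right_mono)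
      finally show ?thesis by (simp add: Suc mult_ac)
    qed
  qed
qed

definition scale_on :: "nat set \<Rightarrow> 'a \<Rightarrow> (nat \<Rightarrow> 'a) \<Rightarrow> nat \<Rightarrow> 'a::times" where
  "scale_on S s z = (\<lambda>i. if i \<in> S then s * z i else z i)"

lemma scale_on_1 [simp]: "scale_on S (1 :: 'a :: monoid_mult) z = z"
  by (auto simp: scale_on_def)

definition restrict_to :: "nat set \<Rightarrow> (nat \<Rightarrow> real) \<Rightarrow> nat \<Rightarrow> real" where
  "restrict_to S z = (\<lambda>i. if i \<in> S then z i else 0)"

text \<open>
  At a positive point \<open>z\<close> the terms of a nonnegative polynomial, divided by its value, form a
  probability distribution on monomials. This is the expected total degree in the variables of \<open>S\<close>.
\<close>

definition mean_degree :: "nat \<Rightarrow> terms \<Rightarrow> nat set \<Rightarrow> (nat \<Rightarrow> real) \<Rightarrow> real" where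
  "mean_degree n ts S z = dir_deriv n ts (restrict_to S z) z / peval n ts z"

text \<open>
  If \<open>w\<close> is not a nonpositive real, then \<open>1\<close> and \<open>w\<close> can be rotated simultaneously into the upper
  half-plane, and homogeneity makes the rotation harmless.
\<close>

lemma scale_on_nonzero:
  assumes st: "stable n ts" and hom: "homog n d ts" and z: "\<And>i. i < n \<Longrightarrow> z i > (0::real)"
    and w: "w \<notin> \<real>\<^sub>\<le>\<^sub>0"
  shows "peval n ts (scale_on S w (\<lambda>i. of_real (z i))) \<noteq> (0 :: complex)"
proof -
  have re: "Re (csqrt w) > 0"
  proof -
    have "Re (csqrt w) \<noteq> 0"
    proof
      assume "Re (csqrt w) = 0"
      then have "csqrt w = \<i> * of_real (Im (csqrt w))" by (simp add: complex_eq_iff)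
      then have "w = (\<i> * of_real (Im (csqrt w)))\<^sup>2" by (metis power2_csqrt)
      then have "w = of_real (- (Im (csqrt w))\<^sup>2)" by (simp add: power_mult_distrib)
      then show False using w by (metis complex_nonpos_Reals_iff Im_complex_of_real Re_complex_of_real neg_le_0_iff_le zero_le_power2)
    qed
    then show ?thesis using csqrt_principal[of w] by linarith
  qed
  \<comment> \<open>This rotation places \<open>1\<close> and \<open>w\<close> symmetrically about the positive imaginary axis.\<close>
  define \<omega> where "\<omega> = \<i> * cnj (csqrt w)"
  have im: "Im \<omega> > 0" using re by (simp add: \<omega>_def)
  have "\<omega> * w = \<i> * (cnj (csqrt w) * csqrt w) * csqrt w"
    unfolding \<omega>_def by (subst power2_csqrt[of w, symmetric]) (simp add: power2_eq_square)
  also have "cnj (csqrt w) * csqrt w = of_real ((cmod (csqrt w))\<^sup>2)"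
    by (simp only: complex_norm_square mult.commute)
  finally have "Im (\<omega> * w) = (cmod (csqrt w))\<^sup>2 * Re (csqrt w)" by simp
  moreover have "csqrt w \<noteq> 0" using re by auto
  ultimately have im2: "Im (\<omega> * w) > 0" using re by simp
  have "Im (\<omega> * scale_on S w (\<lambda>i. of_real (z i)) i) > 0" if "i < n" for i
  proof (cases "i \<in> S")
    case True
    have eq: "\<omega> * scale_on S w (\<lambda>i. of_real (z i)) i = of_real (z i) * (\<omega> * w)"
      using True by (simp add: scale_on_def)
    have "Im (\<omega> * scale_on S w (\<lambda>i. of_real (z i)) i) = z i * Im (\<omega> * w)"
      by (subst eq) simp
    then show ?thesis using im2 z[OF that] by simp
  next
    case False
    then have eq: "\<omega> * scale_on S w (\<lambda>i. of_real (z i)) i = of_real (z i) * \<omega>"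
      by (simp add: scale_on_def)
    have "Im (\<omega> * scale_on S w (\<lambda>i. of_real (z i)) i) = z i * Im \<omega>" by (subst eq) simp
    then show ?thesis using im z[OF that] by simp
  qed
  then have "peval n ts (\<lambda>i. \<omega> * scale_on S w (\<lambda>i. of_real (z i)) i) \<noteq> 0"
    using st by (auto simp: stable_def)
  then show ?thesis by (auto simp: peval_homog[OF hom])
qed

text \<open>
  As a polynomial in the scaling factor \<open>t\<close>, the value splits into factors \<open>t - r\<close> with real \<open>r \<le> 0\<close>.
  Relative to \<open>t = 1\<close> such a factor is \<open>1 + q (t - 1)\<close> with \<open>q = 1 / (1 - r) \<in> [0, 1]\<close>, and the mean degree is the sum of
  the numbers \<open>q\<close>. In probabilistic terms, the degree in \<open>S\<close> is a sum of independent Bernoulli variables. If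
  their mean is at least \<open>k - \<theta>\<close>, then the scaled value grows almost like \<open>s\<^sup>k\<close>.
\<close>

lemma peval_scale_on_ge:
  fixes z :: "nat \<Rightarrow> real"
  assumes st: "stable n ts" and hom: "homog n d ts" and z: "\<And>i. i < n \<Longrightarrow> z i > 0"
    and p: "peval n ts z > 0" and s: "s \<ge> 1" and \<theta>: "0 \<le> \<theta>" "\<theta> \<le> 1"
    and S: "mean_degree n ts S z \<ge> real k - \<theta>"
  shows "s ^ k * (1 - \<theta>) * peval n ts z \<le> peval n ts (scale_on S s z)"
proof -
  define a :: "nat \<Rightarrow> complex" where "a = (\<lambda>i. if i \<in> S then 0 else of_real (z i))"
  obtain P :: "complex poly" where P: "\<And>t. poly P t = peval n ts (\<lambda>i. a i + t * of_real (restrict_to S z i))"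
    using peval_line_poly[where z = a and w = "\<lambda>i. of_real (restrict_to S z i)"] by metis
  have P': "poly P t = peval n ts (scale_on S t (\<lambda>i. of_real (z i)))" for t
    unfolding P by (rule peval_cong) (auto simp: a_def restrict_to_def scale_on_def)
  have Pr: "poly P (of_real t) = of_real (peval n ts (scale_on S t z))" for t
    unfolding P' peval_of_real[symmetric] by (rule peval_cong) (auto simp: scale_on_def)
  have P1: "poly P 1 = of_real (peval n ts z)"
    using Pr[of 1] by simp
  have "P \<noteq> 0" using P1 p by auto
  have "((\<lambda>t. poly P t) has_field_derivative dir_deriv n ts (restrict_to S z) (\<lambda>i. a i + 1 * of_real (restrict_to S z i))) (at 1)"
    unfolding P by (rule has_field_derivative_peval)
  moreover have "dir_deriv n ts (restrict_to S z) (\<lambda>i. a i + 1 * of_real (restrict_to S z i)) = dir_deriv n ts (restrict_to S z) (\<lambda>i. of_real (z i))"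
    by (rule dir_deriv_cong) (auto simp: a_def restrict_to_def)
  ultimately have "(poly P has_field_derivative of_real (dir_deriv n ts (restrict_to S z) z)) (at 1)"
    by (simp add: dir_deriv_of_real)
  from DERIV_unique[OF poly_DERIV this] have dP: "poly (pderiv P) 1 = of_real (dir_deriv n ts (restrict_to S z) z)" .
  let ?M = "proots P"
  define q where "q = (\<lambda>r::complex. 1 / (1 - Re r))"
  have root: "r = of_real (Re r) \<and> Re r \<le> 0" if "r \<in># ?M" for r
  proof -
    have "poly P r = 0" using that \<open>P \<noteq> 0\<close> by simp
    then have "r \<in> \<real>\<^sub>\<le>\<^sub>0" 
      using scale_on_nonzero[where n = n and ts = ts and d = d and z = z and w = r and S = S, OF st hom z]
        P'[of r] by metis
    then show ?thesis by (auto simp: complex_nonpos_Reals_iff complex_eq_iff)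
  qed
  have dec: "P = smult (lead_coeff P) (\<Prod>r\<in>#?M. [:-r, 1:])"
    by (rule complex_poly_decompose_multiset[symmetric])
  have ev: "poly P t = lead_coeff P * (\<Prod>r\<in>#?M. t - r)" for t
    by (subst dec) (simp only: poly_smult poly_prod_mset_linear)
  have q01: "0 \<le> q r \<and> q r \<le> 1" if "r \<in># ?M" for r
    using root[OF that] by (simp add: q_def)
  have ratio: "poly P (of_real t) = poly P 1 * of_real (\<Prod>r\<in>#?M. 1 + q r * (t - 1))" for t
  proof -
    have "(\<Prod>r\<in>#M. of_real t - r) = (\<Prod>r\<in>#M. 1 - r) * of_real (\<Prod>r\<in>#M. 1 + q r * (t - 1))"
      if "\<And>r. r \<in># M \<Longrightarrow> r = of_real (Re r) \<and> Re r \<le> 0" for M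
      using that
    proof (induction M)
      case (add r M)
      have r: "r = of_real (Re r)" "Re r \<le> 0" using add.prems[of r] by auto
      have "(1 - Re r) * (1 + q r * (t - 1)) = t - Re r"
        using r(2) by (simp add: q_def field_simps)
      then have "of_real t - r = (1 - r) * of_real (1 + q r * (t - 1))"
        by (metis r(1) of_real_1 of_real_diff of_real_mult)
      then show ?case using add by (simp add: mult_ac)
    qed simp
    from this[of ?M] root show ?thesis unfolding ev by (simp add: mult.assoc)
  qed
  have dratio: "poly (pderiv P) 1 = poly P 1 * of_real (\<Sum>r\<in>#?M. q r)"
  proof -
    have "poly (pderiv (smult c (\<Prod>r\<in>#M. [:-r, 1:]))) 1 = poly (smult c (\<Prod>r\<in>#M. [:-r, 1:])) 1 * of_real (\<Sum>r\<in>#M. q r)"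
      if "\<And>r. r \<in># M \<Longrightarrow> r = of_real (Re r) \<and> Re r \<le> 0" for M c
      using that
    proof (induction M)
      case (add r M)
      have r: "r = of_real (Re r)" "Re r \<le> 0" using add.prems[of r] by auto
      define g where "g = smult c (\<Prod>r\<in>#M. [:-r, 1:])"
      have IH: "poly (pderiv g) 1 = poly g 1 * of_real (\<Sum>r\<in>#M. q r)"
        using add by (simp add: g_def)
      have eq: "smult c (\<Prod>r\<in>#add_mset r M. [:-r, 1:]) = [:-r, 1:] * g" by (simp add: g_def)
      have f1: "poly (pderiv ([:-r, 1:] * g)) 1 = poly g 1 + (1 - r) * poly (pderiv g) 1"
        by (subst pderiv_mult) (simp add: pderiv_pCons algebra_simps)
      have "(1 - Re r) * q r = 1" using r(2) by (simp add: q_def)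
      then have "(1 - r) * of_real (q r) = 1"
        by (metis r(1) of_real_1 of_real_diff of_real_mult)
      moreover have "(1 - r) * poly g 1 * of_real (q r + (\<Sum>r\<in>#M. q r)) =
          poly g 1 * ((1 - r) * of_real (q r)) + (1 - r) * (poly g 1 * of_real (\<Sum>r\<in>#M. q r))"
        by (simp add: algebra_simps)
      moreover have "poly ([:-r, 1:] * g) 1 = (1 - r) * poly g 1" by (simp add: algebra_simps)
      ultimately show ?case unfolding eq f1 IH by simp
    qed simp
    from this[of ?M "lead_coeff P"] root show ?thesis by (simp only: dec[symmetric])
  qed
  have sumq: "(\<Sum>r\<in>#?M. q r) = mean_degree n ts S z"
  proof -
    have "complex_of_real (dir_deriv n ts (restrict_to S z) z) = of_real (peval n ts z * (\<Sum>r\<in>#?M. q r))"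
      using dratio unfolding dP P1 by simp
    then have "dir_deriv n ts (restrict_to S z) z = peval n ts z * (\<Sum>r\<in>#?M. q r)"
      by (simp only: of_real_eq_iff)
    then show ?thesis using p by (simp add: mean_degree_def)
  qed
  have prod: "peval n ts (scale_on S s z) = peval n ts z * (\<Prod>r\<in>#?M. 1 + q r * (s - 1))"
  proof -
    have "complex_of_real (peval n ts (scale_on S s z)) = of_real (peval n ts z * (\<Prod>r\<in>#?M. 1 + q r * (s - 1)))"
      using ratio[of s] unfolding Pr P1 by simp
    then show ?thesis by (simp only: of_real_eq_iff)
  qed
  have "s ^ k * (1 - \<theta>) \<le> (\<Prod>r\<in>#?M. 1 + q r * (s - 1))"
  proof (cases k)
    case 0
    have "1 - \<theta> \<le> (1 + (s - 1)) ^ 0 * (1 + 0 * (s - 1))" using \<theta> by simp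
    also have "\<dots> \<le> (\<Prod>r\<in>#?M. 1 + q r * (s - 1))"
    proof (rule prod_affine_ge)
      have "0 \<le> (\<Sum>r\<in>#M. q r)" if "\<And>r. r \<in># M \<Longrightarrow> 0 \<le> q r" for M
        using that by (induction M) auto
      then show "real 0 + 0 \<le> (\<Sum>r\<in>#?M. q r)" using q01 by simp
    qed (use s q01 in auto)
    finally show ?thesis using 0 by simp
  next
    case (Suc l)
    \<comment> \<open>Split \<open>k - \<theta>\<close> into its integral part \<open>l\<close> and the fraction \<open>1 - \<theta>\<close>.\<close>
    have le: "(1 + (s - 1)) ^ l * (1 + (1 - \<theta>) * (s - 1)) \<le> (\<Prod>r\<in>#?M. 1 + q r * (s - 1))"
      using S s \<theta> q01 unfolding sumq[symmetric] Suc by (intro prod_affine_ge) auto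
    have "s * (1 - \<theta>) \<le> 1 + (1 - \<theta>) * (s - 1)" using \<theta> by (simp add: algebra_simps)
    then have "s ^ l * (s * (1 - \<theta>)) \<le> s ^ l * (1 + (1 - \<theta>) * (s - 1))"
      using s by (intro mult_left_mono) auto
    with le show ?thesis by (simp add: Suc mult_ac)
  qed
  then have "s ^ k * (1 - \<theta>) * peval n ts z \<le> (\<Prod>r\<in>#?M. 1 + q r * (s - 1)) * peval n ts z"
    using p by (intro mult_right_mono) auto
  then show ?thesis by (simp only: prod mult.commute)
qed

section \<open>Points with almost balanced mean degrees\<close>

text \<open>
  Both sides are derivatives at \<open>0\<close> of \<open>r \<mapsto> p(s (y + r v))\<close>.
\<close>

lemma dir_deriv_homog:
  fixes y :: "nat \<Rightarrow> real"
  assumes "homog n d ts"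
  shows "dir_deriv n ts (\<lambda>i. s * v i) (\<lambda>i. s * y i) = s ^ d * dir_deriv n ts v y"
proof -
  have "((\<lambda>r. peval n ts (\<lambda>i. s * y i + r * of_real (s * v i))) has_field_derivative
      dir_deriv n ts (\<lambda>i. s * v i) (\<lambda>i. s * y i + 0 * of_real (s * v i))) (at 0)"
    by (rule has_field_derivative_peval)
  moreover have "(\<lambda>r. peval n ts (\<lambda>i. s * y i + r * of_real (s * v i))) =
      (\<lambda>r. s ^ d * peval n ts (\<lambda>i. y i + r * of_real (v i)))"
    by (subst peval_homog[OF assms, symmetric]) (simp add: algebra_simps)
  ultimately have 1: "((\<lambda>r. s ^ d * peval n ts (\<lambda>i. y i + r * of_real (v i))) has_field_derivative
      dir_deriv n ts (\<lambda>i. s * v i) (\<lambda>i. s * y i)) (at 0)" by simp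
  have "((\<lambda>r. s ^ d * peval n ts (\<lambda>i. y i + r * of_real (v i))) has_field_derivative
      s ^ d * dir_deriv n ts v (\<lambda>i. y i + 0 * of_real (v i))) (at 0)"
    by (intro DERIV_cmult has_field_derivative_peval)
  from DERIV_unique[OF 1 this] show ?thesis by simp
qed

lemma mean_degree_cmult:
  assumes "homog n d ts" "s > 0"
  shows "mean_degree n ts T (\<lambda>i. s * z i) = mean_degree n ts T z"
proof -
  have "restrict_to T (\<lambda>i. s * z i) = (\<lambda>i. s * restrict_to T z i)" by (auto simp: restrict_to_def)
  then show ?thesis using assms by (simp add: mean_degree_def dir_deriv_homog peval_homog)
qed

lemma mean_degree_eq_sum:
  assumes "T \<subseteq> {..<n}" shows "mean_degree n ts T z = (\<Sum>j\<in>T. mean_degree n ts {j} z)"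
proof -
  have fin: "finite T" using assms by (rule finite_subset) simp
  have 1: "dir_deriv n ts (restrict_to {j} z) z = z j * peval n (partial j ts) z" if "j < n" for j
  proof -
    have "dir_deriv n ts (restrict_to {j} z) z = (\<Sum>i\<in>{j}. restrict_to {j} z i * peval n (partial i ts) z)"
      unfolding dir_deriv_def using that by (intro sum.mono_neutral_cong_right) (auto simp: restrict_to_def)
    then show ?thesis by (simp add: restrict_to_def)
  qed
  have "dir_deriv n ts (restrict_to T z) z = (\<Sum>j\<in>T. z j * peval n (partial j ts) z)"
    unfolding dir_deriv_def using assms by (intro sum.mono_neutral_cong_right) (auto simp: restrict_to_def)
  also have "\<dots> = (\<Sum>j\<in>T. dir_deriv n ts (restrict_to {j} z) z)"
    using assms by (intro sum.cong) (auto simp: 1)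
  finally show ?thesis by (simp add: mean_degree_def sum_divide_distrib)
qed

context
  fixes n :: nat and ts :: terms
  assumes st: "stable n ts" and hom: "homog n n ts" and nn: "nonneg ts"
    and p1: "peval n ts (\<lambda>_. 1) > (0 :: real)"
begin

lemma peval_pos_everywhere: "(\<And>i. i < n \<Longrightarrow> z i > 0) \<Longrightarrow> peval n ts z > (0::real)"
  using peval_pos[OF nn p1] by blast

text \<open>
  By homogeneity, scaling up \<open>S\<close> by \<open>s\<close> acts on mean degrees like scaling down its complement. In the
  opposite direction the complement is scaled up, a nonnegative direction, while the variables in \<open>T\<close> and
  thus the direction of differentiation stay fixed.
\<close>

lemma mean_degree_scale_on_mono:
  fixes z :: "nat \<Rightarrow> real"
  assumes z: "\<And>i. i < n \<Longrightarrow> z i > 0" and s: "s \<ge> 1" and TS: "T \<subseteq> S"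
  shows "mean_degree n ts T z \<le> mean_degree n ts T (scale_on S s z)"
proof -
  define y where "y = (\<lambda>i. if i \<in> S then z i else z i / s)"
  define u where "u = (\<lambda>i. if i \<in> S then 0 else z i - z i / s)"
  have z_eq: "z = (\<lambda>i. y i + 1 * u i)" by (auto simp: y_def u_def)
  have "scale_on S s z = (\<lambda>i. s * y i)" using s by (auto simp: scale_on_def y_def)
  then have eq: "mean_degree n ts T (scale_on S s z) = mean_degree n ts T y"
    using mean_degree_cmult[OF hom, of s T y] s by simp
  have part: "restrict_to T z = restrict_to T y" using TS by (auto simp: restrict_to_def y_def fun_eq_iff)
  have y: "y i > 0" if "i < n" for i using z[OF that] s by (simp add: y_def)
  have u: "u i \<ge> 0" if "i < n" for i
    using z[OF that] s mult_left_mono[of 1 s "z i"] by (auto simp: u_def field_simps)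
  have "dir_deriv n ts (restrict_to T z) (\<lambda>i. y i + 1 * u i) / peval n ts (\<lambda>i. y i + 1 * u i) \<le>
      dir_deriv n ts (restrict_to T z) y / peval n ts y"
  proof (rule log_derivative_antimono[OF st u])
    show "0 \<le> restrict_to T z i" if "i < n" for i using z[OF that] by (simp add: restrict_to_def)
    show "0 < peval n ts (\<lambda>i. y i + r * u i)" if "0 \<le> r" for r
      using y u that by (intro peval_pos_everywhere add_pos_nonneg mult_nonneg_nonneg) auto
  qed auto
  from this[folded z_eq] show ?thesis unfolding eq by (simp add: mean_degree_def part)
qed

text \<open>
  Induction on the number of values of \<open>\<rho>\<close> other than \<open>1\<close>: all of \<open>S = {i. \<rho> i > 1}\<close> is scaled up by the least value
  of \<open>\<rho>\<close> on \<open>S\<close>. The remaining level sets are subsets of \<open>S\<close>, so their mean degrees do not decrease.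
\<close>

lemma chain_scaling:
  fixes z \<rho> :: "nat \<Rightarrow> real"
  assumes z: "\<And>i. i < n \<Longrightarrow> z i > 0" and \<rho>: "\<And>i. i < n \<Longrightarrow> \<rho> i \<ge> 1"
    and \<theta>: "0 \<le> \<theta>" "\<theta> \<le> 1"
    and deg: "\<And>\<tau>. \<tau> \<ge> 1 \<Longrightarrow> real (card {i. i < n \<and> \<rho> i > \<tau>}) - \<theta> \<le> mean_degree n ts {i. i < n \<and> \<rho> i > \<tau>} z"
    and k: "card (\<rho> ` {..<n} - {1}) \<le> k"
  shows "(1 - \<theta>) ^ k * (\<Prod>i<n. \<rho> i) * peval n ts z \<le> peval n ts (\<lambda>i. \<rho> i * z i)"
  using z \<rho> deg k
proof (induction k arbitrary: z \<rho>)
  case 0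
  then have "\<rho> ` {..<n} - {1} = {}" by simp
  then have \<rho>: "\<rho> i = 1" if "i < n" for i using that by blast
  then have "peval n ts (\<lambda>i. \<rho> i * z i) = peval n ts z" by (intro peval_cong) simp
  then show ?case using \<rho> by simp
next
  case (Suc k)
  define S where "S = {i. i < n \<and> \<rho> i > 1}"
  have p: "peval n ts z > 0" using Suc.prems(1) by (rule peval_pos_everywhere)
  show ?case
  proof (cases "S = {}")
    case True
    have \<rho>: "\<rho> i = 1" if "i < n" for i using Suc.prems(2)[OF that] True that by (force simp: S_def)
    then have "peval n ts (\<lambda>i. \<rho> i * z i) = peval n ts z" by (intro peval_cong) simp
    moreover have "(1 - \<theta>) ^ Suc k * peval n ts z \<le> 1 * peval n ts z"
      using \<theta> p by (intro mult_right_mono power_le_one) auto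
    ultimately show ?thesis using \<rho> by simp
  next
    case False
    have fin: "finite S" by (simp add: S_def)
    define s where "s = Min (\<rho> ` S)"
    have s_in: "s \<in> \<rho> ` S" unfolding s_def using fin False by (intro Min_in) auto
    then have s1: "s > 1" by (auto simp: S_def)
    have s_le: "s \<le> \<rho> i" if "i \<in> S" for i unfolding s_def using fin that by (intro Min_le) auto
    define z' where "z' = scale_on S s z"
    define \<rho>' where "\<rho>' = (\<lambda>i. if i \<in> S then \<rho> i / s else \<rho> i)"
    have off: "\<rho> i = 1" if "i < n" "i \<notin> S" for i using Suc.prems(2)[OF that(1)] that by (force simp: S_def)
    have z': "z' i > 0" if "i < n" for i
      using Suc.prems(1)[OF that] s1 by (simp add: z'_def scale_on_def)
    have \<rho>': "\<rho>' i \<ge> 1" if "i < n" for i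
      using Suc.prems(2)[OF that] s_le[of i] s1 by (auto simp: \<rho>'_def)
    have level: "{i. i < n \<and> \<rho>' i > \<tau>} = {i. i < n \<and> \<rho> i > s * \<tau>}" if "\<tau> \<ge> 1" for \<tau>
    proof (rule Collect_cong, rule conj_cong[OF refl])
      fix i assume i: "i < n"
      have st: "s * \<tau> \<ge> 1" using s1 that mult_mono[of 1 s 1 \<tau>] by simp
      show "\<rho>' i > \<tau> \<longleftrightarrow> \<rho> i > s * \<tau>"
        using off[OF i] s1 that st by (auto simp: \<rho>'_def field_simps)
    qed
    have deg': "real (card {i. i < n \<and> \<rho>' i > \<tau>}) - \<theta> \<le> mean_degree n ts {i. i < n \<and> \<rho>' i > \<tau>} z'"
      if "\<tau> \<ge> 1" for \<tau>
    proof -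
      have st: "s * \<tau> \<ge> 1" using s1 that mult_mono[of 1 s 1 \<tau>] by simp
      have sub: "{i. i < n \<and> \<rho> i > s * \<tau>} \<subseteq> S" using st by (auto simp: S_def)
      have "mean_degree n ts {i. i < n \<and> \<rho> i > s * \<tau>} z \<le> mean_degree n ts {i. i < n \<and> \<rho> i > s * \<tau>} z'"
        unfolding z'_def using Suc.prems(1) s1 sub by (intro mean_degree_scale_on_mono) auto
      with Suc.prems(3)[OF st] show ?thesis by (simp add: level[OF that])
    qed
    have card': "card (\<rho>' ` {..<n} - {1}) \<le> k"
    proof -
      have "\<rho>' ` {..<n} - {1} \<subseteq> (\<lambda>v. v / s) ` (\<rho> ` {..<n} - {1} - {s})"
      proof
        fix v assume v: "v \<in> \<rho>' ` {..<n} - {1}"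
        then obtain i where i: "i < n" "v = \<rho>' i" "v \<noteq> 1" by auto
        then have "i \<in> S" using off[OF i(1)] by (cases "i \<in> S") (simp_all add: \<rho>'_def)
        then have "v = \<rho> i / s" "\<rho> i \<noteq> s" "\<rho> i \<noteq> 1" using i s1 by (auto simp: \<rho>'_def S_def)
        then show "v \<in> (\<lambda>v. v / s) ` (\<rho> ` {..<n} - {1} - {s})" using i(1) by auto
      qed
      then have "card (\<rho>' ` {..<n} - {1}) \<le> card ((\<lambda>v. v / s) ` (\<rho> ` {..<n} - {1} - {s}))"
        by (intro card_mono) auto
      also have "\<dots> \<le> card (\<rho> ` {..<n} - {1} - {s})" by (rule card_image_le) auto
      also have "\<dots> < card (\<rho> ` {..<n} - {1})"
        using s_in s1 by (intro card_Diff1_less) (auto simp: S_def)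
      finally show ?thesis using Suc.prems(4) by simp
    qed
    have IH: "(1 - \<theta>) ^ k * (\<Prod>i<n. \<rho>' i) * peval n ts z' \<le> peval n ts (\<lambda>i. \<rho>' i * z' i)"
      using z' \<rho>' deg' card' by (rule Suc.IH)
    have "peval n ts (\<lambda>i. \<rho>' i * z' i) = peval n ts (\<lambda>i. \<rho> i * z i)"
      using s1 by (intro peval_cong) (auto simp: \<rho>'_def z'_def scale_on_def)
    note IH = IH[unfolded this]
    have step: "s ^ card S * (1 - \<theta>) * peval n ts z \<le> peval n ts z'"
      unfolding z'_def using Suc.prems(3)[of 1] s1
      by (intro peval_scale_on_ge[OF st hom Suc.prems(1) p] \<theta>) (auto simp: S_def)
    have prod: "(\<Prod>i<n. \<rho> i) = s ^ card S * (\<Prod>i<n. \<rho>' i)"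
    proof -
      have "(\<Prod>i<n. \<rho> i) = (\<Prod>i<n. (if i \<in> S then s else 1) * \<rho>' i)"
        using s1 by (intro prod.cong) (auto simp: \<rho>'_def)
      also have "\<dots> = (\<Prod>i<n. if i \<in> S then s else 1) * (\<Prod>i<n. \<rho>' i)" by (rule prod.distrib)
      also have "(\<Prod>i<n. if i \<in> S then s else 1) = (\<Prod>i\<in>S. s)"
        by (intro prod.mono_neutral_cong_right) (auto simp: S_def)
      finally show ?thesis by simp
    qed
    have nonneg: "(1 - \<theta>) ^ k * (\<Prod>i<n. \<rho>' i) \<ge> 0"
      using \<theta> \<rho>' by (intro mult_nonneg_nonneg prod_nonneg) (auto intro: order_trans[of 0 1])
    have "(1 - \<theta>) ^ Suc k * (\<Prod>i<n. \<rho> i) * peval n ts z =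
        ((1 - \<theta>) ^ k * (\<Prod>i<n. \<rho>' i)) * (s ^ card S * (1 - \<theta>) * peval n ts z)"
      by (simp add: prod mult_ac)
    also have "\<dots> \<le> ((1 - \<theta>) ^ k * (\<Prod>i<n. \<rho>' i)) * peval n ts z'"
      using step nonneg by (rule mult_left_mono)
    also have "\<dots> \<le> peval n ts (\<lambda>i. \<rho> i * z i)" using IH by (simp add: mult_ac)
    finally show ?thesis .
  qed
qed

text \<open>
  A positive point \<open>y\<close> is, up to a common factor \<open>c\<close>, obtained from \<open>x\<close> by multipliers \<open>\<rho> \<ge> 1\<close>. They take at
  most \<open>n\<close> values, hence \<open>n\<close> scaling steps suffice.
\<close>

lemma near_capacity:
  fixes x y :: "nat \<Rightarrow> real"
  assumes x: "\<And>i. i < n \<Longrightarrow> x i > 0" and y: "\<And>i. i < n \<Longrightarrow> y i > 0" and n: "n \<ge> 1"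
    and \<epsilon>: "0 \<le> \<epsilon>" "real n * \<epsilon> \<le> 1" and grad: "\<And>j. j < n \<Longrightarrow> 1 - \<epsilon> \<le> mean_degree n ts {j} x"
  shows "(1 - real n * \<epsilon>) ^ n * (peval n ts x / (\<Prod>i<n. x i)) * (\<Prod>i<n. y i) \<le> peval n ts y"
proof -
  define c where "c = Min ((\<lambda>i. y i / x i) ` {..<n})"
  have fin: "finite ((\<lambda>i. y i / x i) ` {..<n})" "(\<lambda>i. y i / x i) ` {..<n} \<noteq> {}"
    using n by (auto simp: lessThan_empty_iff)
  have "c \<in> (\<lambda>i. y i / x i) ` {..<n}" unfolding c_def using fin by (rule Min_in)
  then have c: "c > 0" using x y by auto
  have c_le: "c \<le> y i / x i" if "i < n" for i
    unfolding c_def using that fin by (intro Min_le) auto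
  define \<rho> where "\<rho> = (\<lambda>i. y i / (c * x i))"
  have \<rho>: "\<rho> i \<ge> 1" if "i < n" for i
    using c_le[OF that] x[OF that] c by (simp add: \<rho>_def field_simps)
  have deg: "real (card T) - real n * \<epsilon> \<le> mean_degree n ts T (\<lambda>i. c * x i)" if T: "T \<subseteq> {..<n}" for T
  proof -
    have "real (card T) * (1 - \<epsilon>) \<le> (\<Sum>j\<in>T. mean_degree n ts {j} x)"
      using grad T by (intro sum_bounded_below) auto
    moreover have "real (card T) * \<epsilon> \<le> real n * \<epsilon>"
      using \<epsilon> card_mono[OF _ T] by (intro mult_right_mono) auto
    ultimately show ?thesis
      by (simp add: mean_degree_cmult[OF hom c] mean_degree_eq_sum[OF T] algebra_simps)
  qed
  have "card (\<rho> ` {..<n} - {1}) \<le> card (\<rho> ` {..<n})" by (intro card_mono) auto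
  also have "\<dots> \<le> n" using card_image_le[of "{..<n}" \<rho>] by simp
  finally have card: "card (\<rho> ` {..<n} - {1}) \<le> n" .
  have "(1 - real n * \<epsilon>) ^ n * (\<Prod>i<n. \<rho> i) * peval n ts (\<lambda>i. c * x i) \<le>
      peval n ts (\<lambda>i. \<rho> i * (c * x i))"
    by (rule chain_scaling[OF _ \<rho> _ _ _ card]) (use x c \<epsilon> in \<open>auto intro!: deg\<close>)
  also have "peval n ts (\<lambda>i. \<rho> i * (c * x i)) = peval n ts y"
  proof (rule peval_cong)
    fix i assume "i < n"
    then show "\<rho> i * (c * x i) = y i" using x[of i] c by (simp add: \<rho>_def)
  qed
  also have "(\<Prod>i<n. \<rho> i) = (\<Prod>i<n. y i) / (c ^ n * (\<Prod>i<n. x i))"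
    by (simp add: \<rho>_def prod_dividef prod.distrib)
  also have "peval n ts (\<lambda>i. c * x i) = c ^ n * peval n ts x" by (rule peval_homog[OF hom])
  finally show ?thesis using c by (simp add: field_simps)
qed

end

section \<open>The mixed derivative and the stopping criterion\<close>

lemma partial_deriv_peval:
  assumes "i < n" shows "partial_deriv i (peval n ts) = peval n (partial i ts)"
proof
  fix x :: "nat \<Rightarrow> real"
  let ?u = "\<lambda>j. if j = i then 1 else (0::real)"
  have eq: "(\<lambda>j. (x(i := 0)) j + t * ?u j) = x(i := t)" for t by auto
  have "((\<lambda>t. peval n ts (\<lambda>j. (x(i := 0)) j + t * of_real (?u j))) has_field_derivative
      dir_deriv n ts ?u (\<lambda>j. (x(i := 0)) j + x i * of_real (?u j))) (at (x i))"
    by (rule has_field_derivative_peval)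
  then have "((\<lambda>t. peval n ts (x(i := t))) has_field_derivative dir_deriv n ts ?u x) (at (x i))"
    by (simp only: of_real_eq_id id_apply eq fun_upd_triv)
  then have "partial_deriv i (peval n ts) x = dir_deriv n ts ?u x"
    by (simp add: partial_deriv_def DERIV_imp_deriv)
  also have "\<dots> = peval n (partial i ts) x"
    using assms by (simp add: dir_deriv_def if_distrib[of "\<lambda>a. a * _"] sum.delta cong: if_cong)
  finally show "partial_deriv i (peval n ts) x = peval n (partial i ts) x" .
qed

lemma foldr_partial_deriv_peval:
  "set js \<subseteq> {..<n} \<Longrightarrow> foldr partial_deriv js (peval n ts) = peval n (foldr partial js ts)"
  by (induction js) (auto simp: partial_deriv_peval)

text \<open>
  Valid for distinct variables only: a repeated one would produce the falling factorial.
\<close>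

lemma foldr_partial:
  "distinct js \<Longrightarrow> foldr partial js ts =
     map (\<lambda>(c, e). (c * (\<Prod>j\<in>set js. real (e j)), \<lambda>i. if i \<in> set js then e i - 1 else e i)) ts"
proof (induction js)
  case (Cons j js)
  then show ?case by (auto simp: partial_def fun_eq_iff mult_ac)
qed (auto simp: case_prod_unfold)

text \<open>
  At the origin a differentiated term survives only if every exponent was exactly \<open>1\<close>: exponent \<open>0\<close>
  gives a factor \<open>0\<close> in the coefficient, and exponent at least \<open>2\<close> leaves a power of \<open>0\<close>.
\<close>

lemma mixed_derivative_eq_multilinear_coeff:
  assumes "homogeneous n n p"
  shows "mixed_derivative n p = multilinear_coeff n (terms_of p)"
proof -
  have eval: "mpoly_eval p = peval n (terms_of p)"
    using mpoly_eval_terms_of[OF assms] by (rule ext)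
  have tm: "c * (\<Prod>j<n. real (e j)) * (\<Prod>i<n. 0 ^ (if i < n then e i - 1 else e i)) =
      (if \<forall>i<n. e i = 1 then c else 0)" for c :: real and e :: "nat \<Rightarrow> nat"
  proof (cases "\<forall>i<n. e i = 1")
    case False
    then obtain i where i: "i < n" "e i \<noteq> 1" by blast
    have "(\<Prod>j<n. real (e j)) = 0 \<or> (\<Prod>i<n. (0::real) ^ (if i < n then e i - 1 else e i)) = 0"
      using i by (cases "e i = 0") (auto simp: prod_zero_iff intro!: bexI[of _ i])
    then show ?thesis using False by auto
  qed simp
  have "mixed_derivative n p = peval n (foldr partial [0..<n] (terms_of p)) (\<lambda>_. 0)"
    unfolding mixed_derivative_def eval by (subst foldr_partial_deriv_peval) auto
  also have "\<dots> = (\<Sum>(c, e)\<leftarrow>terms_of p. c * (\<Prod>j<n. real (e j)) *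
      (\<Prod>i<n. 0 ^ (if i < n then e i - 1 else e i)))"
    by (simp add: foldr_partial peval_def case_prod_unfold o_def atLeast0LessThan)
  also have "\<dots> = multilinear_coeff n (terms_of p)"
    by (simp only: multilinear_coeff_def tm)
  finally show ?thesis .
qed

lemma multilinear_coeff_Nats:
  assumes "nonneg_int_coeffs p" shows "multilinear_coeff n (terms_of p) \<in> \<nat>"
proof -
  have "(\<Sum>\<alpha>\<in>A. g \<alpha>) \<in> \<nat>" if "\<And>\<alpha>. g \<alpha> \<in> (\<nat> :: real set)" for A and g :: "(nat \<Rightarrow>\<^sub>0 nat) \<Rightarrow> real"
    using that by (induction A rule: infinite_finite_induct) auto
  then show ?thesis
    unfolding multilinear_coeff_def sum_list_terms_of using assms by (auto simp: nonneg_int_coeffs_def)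
qed

lemma multilinear_coeff_le:
  fixes x :: "nat \<Rightarrow> real"
  assumes "nonneg ts" "\<And>i. i < n \<Longrightarrow> x i > 0"
  shows "multilinear_coeff n ts * (\<Prod>i<n. x i) \<le> peval n ts x"
  using assms(1)
proof (induction ts)
  case (Cons ce ts)
  obtain c e where [simp]: "ce = (c, e)" by force
  have IH: "multilinear_coeff n ts * (\<Prod>i<n. x i) \<le> peval n ts x" and c: "c \<ge> 0"
    using Cons by (auto simp: nonneg_def)
  have "(if \<forall>i<n. e i = 1 then c else 0) * (\<Prod>i<n. x i) \<le> c * (\<Prod>i<n. x i ^ e i)"
    using c assms(2) by (auto intro!: mult_nonneg_nonneg prod_nonneg intro: less_imp_le)
  then show ?case using IH by (simp add: multilinear_coeff_def algebra_simps)
qed (simp add: multilinear_coeff_def)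

text \<open>
  If increasing coordinate \<open>j\<close> fails, then log-concavity forces
  \<open>ln (1 + \<delta> - \<delta>\<^sup>2) \<le> \<delta> g\<close> for the mean degree \<open>g\<close> of variable \<open>j\<close>, hence \<open>g \<ge> 1 - 2 \<delta>\<close>. The value of \<open>\<delta>\<close> is
  chosen such that \<open>2 \<delta> n = 1 / (n + 1)\<close>: then the factor lost by \<open>near_capacity\<close> is
  \<open>(1 + 1 / n)\<^sup>n \<le> e\<close>, which together with \<open>e\<^sup>n\<^sup>-\<^sup>1\<close> from \<open>capacity_le_multilinear_coeff\<close> makes \<open>e\<^sup>n\<close>.
\<close>

lemma stuck_bound:
  fixes x :: "nat \<Rightarrow> real"
  assumes st: "stable n ts" and hom: "homog n n ts" and nn: "nonneg ts"
    and p1: "peval n ts (\<lambda>_. 1) > (0 :: real)" and n: "n \<ge> 1"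
    and x: "\<And>i. i < n \<Longrightarrow> x i > 0"
    and \<delta>: "\<delta> = 1 / (2 * real n * (real n + 1))"
    and stuck: "\<And>j. j < n \<Longrightarrow> (1 + \<delta> - \<delta>\<^sup>2) * peval n ts x \<le> peval n ts (x(j := x j * (1 + \<delta>)))"
  shows "peval n ts x / (\<Prod>i<n. x i) \<le> exp 1 ^ n * multilinear_coeff n ts"
proof -
  have px: "peval n ts x > 0" using peval_pos_everywhere[OF st hom nn p1 x] .
  have \<delta>0: "\<delta> > 0" using n by (simp add: \<delta>)
  have n2: "real n * (2 * \<delta>) = 1 / (real n + 1)"
  proof -
    have "real n \<noteq> 0" "real n + 1 \<noteq> 0" using n by auto
    then show ?thesis by (simp add: \<delta> divide_simps)
  qed
  have "1 * 2 \<le> 2 * real n * (real n + 1)" using n by (intro mult_mono) auto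
  then have \<delta>1: "\<delta> \<le> 1 / 2" unfolding \<delta> by (intro divide_left_mono) auto
  have grad: "1 - 2 * \<delta> \<le> mean_degree n ts {j} x" if j: "j < n" for j
  proof -
    have eq: "(\<lambda>i. x i + \<delta> * restrict_to {j} x i) = x(j := x j * (1 + \<delta>))"
      by (auto simp: restrict_to_def algebra_simps)
    have "peval n ts (\<lambda>i. x i + \<delta> * restrict_to {j} x i) \<le>
        peval n ts x * exp (\<delta> * (dir_deriv n ts (restrict_to {j} x) x / peval n ts x))"
    proof (rule peval_le_exp[OF st])
      show "restrict_to {j} x i \<ge> 0" if "i < n" for i using x[OF that] by (auto simp: restrict_to_def)
      show "peval n ts (\<lambda>i. x i + r * restrict_to {j} x i) > 0" if "r \<ge> 0" for r
        using x that by (intro peval_pos_everywhere[OF st hom nn p1] add_pos_nonneg mult_nonneg_nonneg) (auto simp: restrict_to_def intro: less_imp_le)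
    qed (use \<delta>0 in simp)
    then have "(1 + \<delta> - \<delta>\<^sup>2) * peval n ts x \<le> exp (\<delta> * mean_degree n ts {j} x) * peval n ts x"
      using stuck[OF j] by (simp add: eq mean_degree_def mult.commute)
    then have le: "1 + \<delta> - \<delta>\<^sup>2 \<le> exp (\<delta> * mean_degree n ts {j} x)" using px by simp
    define y where "y = \<delta> - \<delta>\<^sup>2"
    have "\<delta>\<^sup>2 \<le> \<delta>" using \<delta>0 \<delta>1 mult_left_mono[of \<delta> 1 \<delta>] by (simp add: power2_eq_square)
    moreover have "\<delta>\<^sup>2 \<ge> 0" by simp
    ultimately have y: "0 \<le> y" "y \<le> \<delta>" "y \<le> 1 / 2" using \<delta>1 unfolding y_def by linarith+
    have "\<delta> * (1 - 2 * \<delta>) = \<delta> - \<delta>\<^sup>2 - \<delta>\<^sup>2" by (simp add: algebra_simps power2_eq_square)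
    also have "\<dots> \<le> y - y\<^sup>2" using y by (simp add: y_def power_mono)
    also have "\<dots> \<le> ln (1 + y)" using y by (intro ln_one_plus_pos_lower_bound) auto
    also have "\<dots> \<le> \<delta> * mean_degree n ts {j} x"
    proof -
      have "ln (1 + y) \<le> ln (exp (\<delta> * mean_degree n ts {j} x))" using le y by (intro ln_mono) (auto simp: y_def)
      then show ?thesis by simp
    qed
    finally show ?thesis using \<delta>0 by simp
  qed
  define \<theta> where "\<theta> = 1 / (real n + 1)"
  define C where "C = (1 - \<theta>) ^ n * (peval n ts x / (\<Prod>i<n. x i))"
  have X: "(\<Prod>i<n. x i) > 0" using x by (intro prod_pos) auto
  have cap: "C * (\<Prod>i<n. y i) \<le> peval n ts y" if "\<And>i. i < n \<Longrightarrow> y i > 0" for y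
    using near_capacity[OF st hom nn p1 x that n, where \<epsilon> = "2 * \<delta>"] grad \<delta>0 n2
    by (simp add: C_def \<theta>_def)
  have e: "1 / exp 1 \<le> (1 - \<theta>) ^ n"
  proof -
    have "1 - \<theta> = 1 / (1 + 1 / real n)" using n by (simp add: \<theta>_def field_simps)
    moreover have "(1 + 1 / real n) ^ n \<le> exp (1 / real n) ^ n"
      by (intro power_mono exp_ge_add_one_self) auto
    moreover have "exp (1 / real n) ^ n = exp 1" using n by (simp flip: exp_of_nat_mult)
    ultimately have *: "(1 - \<theta>) ^ n = 1 / (1 + 1 / real n) ^ n" "(1 + 1 / real n) ^ n \<le> exp 1"
      by (simp_all add: power_one_over)
    show ?thesis unfolding *(1)
      using n by (intro frac_le *(2) zero_less_power add_pos_nonneg) auto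
  qed
  have C: "peval n ts x / (\<Prod>i<n. x i) \<le> exp 1 * C"
  proof -
    have "1 \<le> exp 1 * (1 - \<theta>) ^ n" using e by (simp add: field_simps)
    then have "1 * (peval n ts x / (\<Prod>i<n. x i)) \<le> exp 1 * (1 - \<theta>) ^ n * (peval n ts x / (\<Prod>i<n. x i))"
      by (rule mult_right_mono) (intro divide_nonneg_nonneg less_imp_le px X)
    then show ?thesis by (simp only: C_def mult_1 mult.assoc)
  qed
  have "C > 0"
  proof -
    have "0 < peval n ts x / (\<Prod>i<n. x i)" using px X by simp
    also note C
    finally show ?thesis by (simp add: zero_less_mult_iff)
  qed
  obtain m where m: "n = Suc m" using n by (cases n) auto
  have "C \<le> exp 1 ^ m * multilinear_coeff n ts"
    using capacity_le_multilinear_coeff[of ts m C] nn hom st \<open>C > 0\<close> cap by (simp add: m)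
  then have "exp 1 * C \<le> exp 1 ^ n * multilinear_coeff n ts" by (simp add: m)
  with C show ?thesis by simp
qed

section \<open>A coordinate search program\<close>

fun loop_free :: "com \<Rightarrow> bool" where
  "loop_free (Seq c1 c2) \<longleftrightarrow> loop_free c1 \<and> loop_free c2"
| "loop_free (IfLess e1 e2 c1 c2) \<longleftrightarrow> loop_free c1 \<and> loop_free c2"
| "loop_free (WhileLess e1 e2 c) \<longleftrightarrow> False"
| "loop_free c \<longleftrightarrow> True"

text \<open>
  Programs without loops can be evaluated by rewriting. The last equation is the
  correct result for \<open>Skip\<close> and a dummy value for loops.
\<close>

fun run :: "(rat list \<Rightarrow> rat) \<Rightarrow> nat \<Rightarrow> com \<Rightarrow> store \<Rightarrow> store \<times> rat list list \<times> nat" where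
  "run f n (Assign a i e) s = (store_update s a (aval i s) (aval e s), [], 1 + asteps i + asteps e)"
| "run f n (Query a i b) s =
     (let q = map (\<lambda>k. s b (of_nat k)) [0..<n] in (store_update s a (aval i s) (f q), [q], 1 + asteps i))"
| "run f n (Seq c1 c2) s =
     (let (s', qs, t) = run f n c1 s; (s'', qs', t') = run f n c2 s' in (s'', qs @ qs', t + t'))"
| "run f n (IfLess e1 e2 c1 c2) s =
     (let (s', qs, t) = run f n (if aval e1 s < aval e2 s then c1 else c2) s
      in (s', qs, 1 + asteps e1 + asteps e2 + t))"
| "run f n c s = (s, [], 0)"

lemma exec_run:
  "loop_free c \<Longrightarrow> run f n c s = (s', qs, t) \<Longrightarrow> exec f n c s s' qs t"
proof (induction c arbitrary: s s' qs t)
  case (Assign a i e)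
  then show ?case using exec.Assign[where f = f and n = n and a = a and i = i and e = e and s = s] by simp
next
  case (Query a i b)
  then show ?case using exec.Query[OF refl, where f = f and n = n and a = a and i = i and b = b and s = s] by (auto simp: Let_def)
next
  case (Seq c1 c2)
  then show ?case by (auto split: prod.splits intro!: exec.Seq)
next
  case (IfLess e1 e2 c1 c2)
  show ?case
  proof (cases "aval e1 s < aval e2 s")
    case True
    with IfLess.prems obtain t' where *: "run f n c1 s = (s', qs, t')" "t = 1 + asteps e1 + asteps e2 + t'"
      by (auto split: prod.splits)
    from IfLess.IH(1)[OF _ *(1)] IfLess.prems(1) have "exec f n c1 s s' qs t'" by simp
    from exec.IfTrue[OF True this] show ?thesis unfolding *(2) .
  next
    case False
    with IfLess.prems obtain t' where *: "run f n c2 s = (s', qs, t')" "t = 1 + asteps e1 + asteps e2 + t'"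
      by (auto split: prod.splits)
    from IfLess.IH(2)[OF _ *(1)] IfLess.prems(1) have "exec f n c2 s s' qs t'" by simp
    from exec.IfFalse[OF False this] show ?thesis unfolding *(2) .
  qed
qed (auto intro: exec.Skip)

text \<open>
  A run evaluates its function argument at vectors of length \<open>n\<close> only.
\<close>

lemma exec_cong:
  assumes "exec f n c s s' qs t" and "\<And>q. length q = n \<Longrightarrow> f q = f' q"
  shows "exec f' n c s s' qs t"
  using assms(1)
proof (induction rule: exec.induct)
  case (Query q s b a i)
  then show ?case using exec.Query[where f = f' and q = q and s = s and b = b and n = n and a = a and i = i] assms(2)[of q] by simp
next
  case (Seq c1 s s' qs t c2 s'' qs' t')
  from Seq.IH show ?case by (rule exec.Seq)
next
  case (IfTrue e1 s e2 c1 s' qs t c2)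
  from IfTrue.hyps(1) IfTrue.IH show ?case by (rule exec.IfTrue)
next
  case (IfFalse e1 s e2 c2 s' qs t c1)
  from IfFalse.hyps(1) IfFalse.IH show ?case by (rule exec.IfFalse)
next
  case (WhileFalse e1 s e2 c)
  then show ?case by (rule exec.WhileFalse)
next
  case (WhileTrue e1 s e2 c s' qs t s'' qs' t')
  from WhileTrue.hyps(1) WhileTrue.IH show ?case by (rule exec.WhileTrue)
qed (rule exec.Skip exec.Assign)+

abbreviation scalar :: "nat \<Rightarrow> aexp" where "scalar a \<equiv> Cell a (Const 0)"
abbreviation set_scalar :: "nat \<Rightarrow> aexp \<Rightarrow> com" where "set_scalar a e \<equiv> Assign a (Const 0) e"

text \<open>
  Array \<open>1\<close> holds the current point, and cell \<open>0\<close> of the further arrays holds a scalar: the value of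
  the polynomial (array \<open>2\<close>), the product of the coordinates (\<open>3\<close>), the coordinate under test (\<open>4\<close>), the value
  at the tentative point (\<open>5\<close>), \<open>1 + \<delta>\<close> (\<open>6\<close>) and \<open>1 + \<delta> - \<delta>\<^sup>2\<close> (\<open>7\<close>).
\<close>

definition init_loop :: com where
  "init_loop = WhileLess (scalar 4) (scalar 0)
     (Seq (Assign 1 (scalar 4) (Const 1)) (set_scalar 4 (Add (scalar 4) (Const 1))))"

definition prepare :: com where
  "prepare =
     Seq (set_scalar 4 (Const 0))
     (Seq (Query 2 (Const 0) 1)
     (Seq (set_scalar 3 (Const 1))
     (Seq (set_scalar 6 (Add (Const 1)
            (Div (Const 1) (Mul (Const 2) (Mul (scalar 0) (Add (scalar 0) (Const 1)))))))
          (set_scalar 7 (Sub (scalar 6)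
            (Mul (Sub (scalar 6) (Const 1)) (Sub (scalar 6) (Const 1))))))))"

text \<open>
  After an accepted move all coordinates have to be tested again, so the counter returns to \<open>0\<close>. If
  the value has dropped below the product of the coordinates, the counter is set to \<open>n\<close>, which ends the
  search.
\<close>

definition try_coordinate :: com where
  "try_coordinate =
     Seq (Assign 1 (scalar 4) (Mul (Cell 1 (scalar 4)) (scalar 6)))
     (Seq (Query 5 (Const 0) 1)
       (IfLess (scalar 5) (Mul (scalar 7) (scalar 2))
         (Seq (set_scalar 2 (scalar 5))
         (Seq (set_scalar 3 (Mul (scalar 3) (scalar 6)))
           (IfLess (scalar 2) (scalar 3)
             (set_scalar 4 (scalar 0))
             (set_scalar 4 (Const 0)))))
         (Seq (Assign 1 (scalar 4) (Div (Cell 1 (scalar 4)) (scalar 6)))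
           (set_scalar 4 (Add (scalar 4) (Const 1))))))"

definition search :: com where
  "search = WhileLess (scalar 4) (scalar 0) try_coordinate"

text \<open>
  The search ends either with a value below the product of the coordinates, which proves that the
  mixed derivative is \<open>0\<close>, or with an approximate minimum.
\<close>

definition report :: com where
  "report = IfLess (scalar 2) (scalar 3)
     (set_scalar 0 (Const 0)) (set_scalar 0 (Div (scalar 2) (scalar 3)))"

definition prog :: com where
  "prog = Seq init_loop (Seq prepare (Seq search report))"

definition growth :: "nat \<Rightarrow> rat" where
  "growth n = 1 + 1 / (2 * (of_nat n * (of_nat n + 1)))"

definition threshold :: "nat \<Rightarrow> rat" where
  "threshold n = growth n - (growth n - 1) * (growth n - 1)"

text \<open>
  The search visits only these points; the exponents \<open>k\<close> count the accepted moves.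
\<close>

definition grid :: "nat \<Rightarrow> (nat \<Rightarrow> nat) \<Rightarrow> rat list" where
  "grid n k = map (\<lambda>i. growth n ^ k i) [0..<n]"

definition weight :: "nat \<Rightarrow> (nat \<Rightarrow> nat) \<Rightarrow> nat" where
  "weight n k = (\<Sum>i<n. k i)"

definition store_repr :: "(rat list \<Rightarrow> rat) \<Rightarrow> nat \<Rightarrow> (nat \<Rightarrow> nat) \<Rightarrow> nat \<Rightarrow> store \<Rightarrow> bool" where
  "store_repr f n k j s \<longleftrightarrow>
     s 0 0 = of_nat n \<and> (\<forall>i<n. s 1 (of_nat i) = growth n ^ k i) \<and>
     s 2 0 = f (grid n k) \<and> s 3 0 = growth n ^ weight n k \<and> s 4 0 = of_nat j \<and>
     s 6 0 = growth n \<and> s 7 0 = threshold n"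

lemma growth_gt_1: "n \<ge> 1 \<Longrightarrow> growth n > 1"
  by (simp add: growth_def zero_less_mult_iff)

lemma weight_inc: "j < n \<Longrightarrow> weight n (k(j := Suc (k j))) = Suc (weight n k)"
proof -
  assume j: "j < n"
  have "weight n (k(j := Suc (k j))) = (\<Sum>i<n. k i + (if i = j then 1 else 0))"
    unfolding weight_def by (intro sum.cong) auto
  then show ?thesis using j by (simp add: sum.distrib weight_def)
qed

lemma store_update_apply:
  "store_update s a i v a' i' = (if a' = a \<and> i' = i then v else s a' i')"
  by (simp add: store_update_def)

lemma exec_try_coordinate:
  assumes "store_repr f n k j s" and j: "j < n" and n: "n \<ge> 1"
  defines "k' \<equiv> k(j := Suc (k j))"
  shows "\<exists>s' t. exec f n try_coordinate s s' [grid n k'] t \<and> t \<le> 60 \<and>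
     (if f (grid n k') < threshold n * f (grid n k)
      then store_repr f n k' (if f (grid n k') < growth n ^ weight n k' then n else 0) s'
      else store_repr f n k (Suc j) s')"
proof -
  have g: "growth n \<noteq> 0" using growth_gt_1[OF n] by simp
  obtain s' qs t where run: "run f n try_coordinate s = (s', qs, t)" by (cases "run f n try_coordinate s") auto
  have s: "s 0 0 = of_nat n" "\<And>i. i < n \<Longrightarrow> s (Suc 0) (of_nat i) = growth n ^ k i"
    "s 2 0 = f (grid n k)" "s 3 0 = growth n ^ weight n k" "s 4 0 = of_nat j"
    "s 6 0 = growth n" "s 7 0 = threshold n"
    using assms(1) by (auto simp: store_repr_def)
  have k': "growth n ^ k' i = (if i = j then growth n ^ k j * growth n else growth n ^ k i)" for i
    by (simp add: k'_def)
  have q: "map (\<lambda>i. if i = j then growth n ^ k j * growth n else s (Suc 0) (of_nat i)) [0..<n] = grid n k'"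
    unfolding grid_def by (rule map_cong) (auto simp: s(2) k')
  have w: "growth n ^ weight n k' = growth n ^ weight n k * growth n"
    unfolding k'_def by (simp add: weight_inc[OF j])
  have "exec f n try_coordinate s s' qs t" by (rule exec_run[OF _ run]) (simp add: try_coordinate_def)
  moreover have "qs = [grid n k'] \<and> t \<le> 60 \<and>
     (if f (grid n k') < threshold n * f (grid n k)
      then store_repr f n k' (if f (grid n k') < growth n ^ weight n k' then n else 0) s'
      else store_repr f n k (Suc j) s')"
  proof (cases "f (grid n k') < threshold n * f (grid n k)")
    case True
    show ?thesis
    proof (cases "f (grid n k') < growth n ^ weight n k'")
      case light: True
      then show ?thesis
        using run True g
        by (auto simp: try_coordinate_def store_update_apply s j q w Let_def store_repr_def k')
    next
      case heavy: False
      then show ?thesis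
        using run True g
        by (auto simp: try_coordinate_def store_update_apply s j q w Let_def store_repr_def k')
    qed
  next
    case False
    then show ?thesis
      using run g by (auto simp: try_coordinate_def store_update_apply s j q Let_def store_repr_def)
  qed
  ultimately show ?thesis by blast
qed

section \<open>Runs of the program\<close>

lemma exec_init_loop:
  assumes "s 0 0 = of_nat n" "s 4 0 = of_nat j" "j \<le> n" "\<forall>i<j. s 1 (of_nat i) = 1"
  shows "\<exists>s' t. exec f n init_loop s s' [] t \<and> t \<le> 5 + 20 * (n - j) \<and>
     s' 0 0 = of_nat n \<and> (\<forall>i<n. s' 1 (of_nat i) = 1)"
  using assms
proof (induction "n - j" arbitrary: j s)
  case 0
  have "exec f n init_loop s s [] (1 + asteps (scalar 4) + asteps (scalar 0))"
    unfolding init_loop_def using 0 by (intro exec.WhileFalse) simp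
  then show ?case using 0 by (intro exI[of _ s] exI[of _ 5]) (simp add: numeral_eq_Suc)
next
  case (Suc d)
  let ?body = "Seq (Assign 1 (scalar 4) (Const 1)) (set_scalar 4 (Add (scalar 4) (Const 1)))"
  obtain s1 qs1 t1 where run: "run f n ?body s = (s1, qs1, t1)" by (cases "run f n ?body s") auto
  have ex: "exec f n ?body s s1 qs1 t1" by (rule exec_run[OF _ run]) simp
  have s1: "qs1 = []" "t1 \<le> 12" "s1 0 0 = of_nat n" "s1 4 0 = of_nat (Suc j)"
    "\<forall>i<Suc j. s1 1 (of_nat i) = 1"
    using run Suc.prems by (auto simp: store_update_apply less_Suc_eq)
  have "d = n - Suc j" "Suc j \<le> n" using Suc.hyps(2) by auto
  from Suc.hyps(1)[OF this(1) s1(3,4) this(2) s1(5)] obtain s' t where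
    s': "exec f n init_loop s1 s' [] t" "t \<le> 5 + 20 * (n - Suc j)" "s' 0 0 = of_nat n"
      "\<forall>i<n. s' 1 (of_nat i) = 1" by blast
  have "aval (scalar 4) s < aval (scalar 0) s" using Suc.prems Suc.hyps(2) by simp
  from exec.WhileTrue[OF this ex s'(1)[unfolded init_loop_def]]
  have "exec f n init_loop s s' [] (1 + asteps (scalar 4) + asteps (scalar 0) + t1 + t)"
    unfolding init_loop_def by (simp add: s1(1))
  moreover have "1 + asteps (scalar 4) + asteps (scalar 0) + t1 + t \<le> 5 + 20 * (n - j)"
    using s1(2) s'(2) Suc.hyps(2) by simp
  ultimately show ?case using s'(3,4) by blast
qed

lemma exec_prepare:
  assumes "s 0 0 = of_nat n" "\<forall>i<n. s 1 (of_nat i) = 1"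
  shows "\<exists>s' t. exec f n prepare s s' [grid n (\<lambda>_. 0)] t \<and> t \<le> 60 \<and> store_repr f n (\<lambda>_. 0) 0 s'"
proof -
  obtain s' qs t where run: "run f n prepare s = (s', qs, t)" by (cases "run f n prepare s") auto
  have q: "map (\<lambda>i. s (Suc 0) (of_nat i)) [0..<n] = grid n (\<lambda>_. 0)"
    unfolding grid_def using assms(2) by (intro map_cong) auto
  have "exec f n prepare s s' qs t" by (rule exec_run[OF _ run]) (simp add: prepare_def)
  moreover have "qs = [grid n (\<lambda>_. 0)] \<and> t \<le> 60 \<and> store_repr f n (\<lambda>_. 0) 0 s'"
    using run assms
    by (auto simp: prepare_def store_update_apply Let_def q store_repr_def growth_def threshold_def weight_def)
  ultimately show ?thesis by blast
qed

lemma exec_report: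
  assumes "store_repr f n k j s"
  shows "\<exists>s' t. exec f n report s s' [] t \<and> t \<le> 20 \<and>
     final_output s' = (if f (grid n k) < growth n ^ weight n k then 0
                        else f (grid n k) / growth n ^ weight n k)"
proof -
  obtain s' qs t where run: "run f n report s = (s', qs, t)" by (cases "run f n report s") auto
  have "exec f n report s s' qs t" by (rule exec_run[OF _ run]) (simp add: report_def)
  moreover have "qs = [] \<and> t \<le> 20 \<and>
     final_output s' = (if f (grid n k) < growth n ^ weight n k then 0
                        else f (grid n k) / growth n ^ weight n k)"
    using run assms
    by (cases "f (grid n k) < growth n ^ weight n k")
       (auto simp: report_def store_update_apply store_repr_def final_output_def)
  ultimately show ?thesis by blast
qed

lemma threshold_pos:
  assumes "n \<ge> 1" shows "threshold n > 0"
proof -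
  define d :: rat where "d = growth n - 1"
  have d: "d > 0" using growth_gt_1[OF assms] by (simp add: d_def)
  have "1 * 1 \<le> (of_nat n * (of_nat n + 1) :: rat)" using assms by (intro mult_mono) auto
  then have "d \<le> 1" by (simp add: d_def growth_def)
  then have "d * d \<le> d" using d mult_left_mono[of d 1 d] by simp
  moreover have "threshold n = 1 + d - d * d" by (simp add: threshold_def d_def)
  ultimately show ?thesis using d by linarith
qed

text \<open>
  The second conjunct bounds the value after \<open>weight n k\<close> accepted moves, while the product of the
  coordinates is \<open>growth n ^ weight n k\<close>. The failed tests are recorded only for a value not below that
  product, since otherwise the counter \<open>j\<close> has jumped to \<open>n\<close>.
\<close>

definition search_inv :: "(rat list \<Rightarrow> rat) \<Rightarrow> nat \<Rightarrow> (nat \<Rightarrow> nat) \<Rightarrow> nat \<Rightarrow> bool" where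
  "search_inv f n k j \<longleftrightarrow> j \<le> n \<and>
     f (grid n k) \<le> f (grid n (\<lambda>_. 0)) * threshold n ^ weight n k \<and>
     (j < n \<longrightarrow> growth n ^ weight n k \<le> f (grid n k)) \<and>
     (growth n ^ weight n k \<le> f (grid n k) \<longrightarrow>
        (\<forall>i<j. threshold n * f (grid n k) \<le> f (grid n (k(i := Suc (k i))))))"

text \<open>
  The hypothesis on \<open>M\<close> bounds the number of accepted moves made while the value is at least the
  product of the coordinates; one more move may end the search. An accepted move resets the counter but
  raises the weight, so \<open>(M + 1 - weight) (n + 1) + (n - j)\<close> decreases in every round.
\<close>

lemma exec_search:
  assumes n: "n \<ge> 1"
    and M: "\<And>w. growth n ^ w \<le> f (grid n (\<lambda>_. 0)) * threshold n ^ w \<Longrightarrow> w \<le> M"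
    and "store_repr f n k j s" "search_inv f n k j"
  shows "\<exists>k' s' qs t. exec f n search s s' qs t \<and> store_repr f n k' n s' \<and> search_inv f n k' n \<and>
     length qs \<le> (M + 1 - weight n k) * (n + 1) + (n - j) \<and>
     t \<le> 5 + 65 * ((M + 1 - weight n k) * (n + 1) + (n - j)) \<and>
     (\<forall>q\<in>set qs. \<exists>k''. q = grid n k'' \<and> weight n k'' \<le> M + 1)"
  using assms(3,4)
proof (induction "(M + 1 - weight n k) * (n + 1) + (n - j)" arbitrary: k j s rule: less_induct)
  case less
  let ?m = "(M + 1 - weight n k) * (n + 1) + (n - j)"
  have s: "s 0 0 = of_nat n" "s 4 0 = of_nat j" using less.prems(1) by (auto simp: store_repr_def)
  have "j \<le> n" using less.prems(2) by (simp add: search_inv_def)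
  show ?case
  proof (cases "j < n")
    case False
    then have "j = n" using \<open>j \<le> n\<close> by simp
    have "exec f n search s s [] (1 + asteps (scalar 4) + asteps (scalar 0))"
      unfolding search_def using s \<open>j = n\<close> by (intro exec.WhileFalse) simp
    then show ?thesis using less.prems \<open>j = n\<close>
      by (intro exI[of _ k] exI[of _ s] exI[of _ "[]"] exI[of _ 5]) (simp add: numeral_eq_Suc)
  next
    case True
    define k' where "k' = k(j := Suc (k j))"
    have w': "weight n k' = Suc (weight n k)" unfolding k'_def by (rule weight_inc[OF True])
    have heavy: "growth n ^ weight n k \<le> f (grid n k)"
      and dec: "f (grid n k) \<le> f (grid n (\<lambda>_. 0)) * threshold n ^ weight n k"
      and tested: "\<forall>i<j. threshold n * f (grid n k) \<le> f (grid n (k(i := Suc (k i))))"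
      using less.prems(2) True by (auto simp: search_inv_def)
    have wM: "weight n k \<le> M" using heavy dec by (intro M) simp
    obtain s1 t1 where s1: "exec f n try_coordinate s s1 [grid n k'] t1" "t1 \<le> 60"
      "if f (grid n k') < threshold n * f (grid n k)
       then store_repr f n k' (if f (grid n k') < growth n ^ weight n k' then n else 0) s1
       else store_repr f n k (Suc j) s1"
      using exec_try_coordinate[OF less.prems(1) True n] unfolding k'_def by blast
    have "\<exists>k1 j1. store_repr f n k1 j1 s1 \<and> search_inv f n k1 j1 \<and>
        Suc ((M + 1 - weight n k1) * (n + 1) + (n - j1)) \<le> ?m"
    proof (cases "f (grid n k') < threshold n * f (grid n k)")
      case acc: True
      define j1 where "j1 = (if f (grid n k') < growth n ^ weight n k' then n else 0)"
      have "f (grid n k') \<le> threshold n * (f (grid n (\<lambda>_. 0)) * threshold n ^ weight n k)"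
        using acc mult_left_mono[OF dec less_imp_le[OF threshold_pos[OF n]]] by simp
      then have "search_inv f n k' j1"
        using n by (auto simp: search_inv_def w' j1_def mult_ac)
      moreover have "store_repr f n k' j1 s1" using s1(3) acc by (simp add: j1_def)
      moreover have "Suc ((M + 1 - weight n k') * (n + 1) + (n - j1)) \<le> ?m"
      proof -
        have "M + 1 - weight n k = Suc (M + 1 - weight n k')" using wM w' by simp
        then show ?thesis using True by simp
      qed
      ultimately show ?thesis by blast
    next
      case rej: False
      have "search_inv f n k (Suc j)"
        using less.prems(2) True rej tested by (auto simp: search_inv_def less_Suc_eq k'_def)
      moreover have "store_repr f n k (Suc j) s1" using s1(3) rej by simp
      moreover have "Suc ((M + 1 - weight n k) * (n + 1) + (n - Suc j)) \<le> ?m" using True by simp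
      ultimately show ?thesis by blast
    qed
    then obtain k1 j1 where k1: "store_repr f n k1 j1 s1" "search_inv f n k1 j1"
      "Suc ((M + 1 - weight n k1) * (n + 1) + (n - j1)) \<le> ?m" by blast
    from less.hyps[OF _ k1(1,2)] k1(3) obtain k2 s2 qs t where
      IH: "exec f n search s1 s2 qs t" "store_repr f n k2 n s2" "search_inv f n k2 n"
        "length qs \<le> (M + 1 - weight n k1) * (n + 1) + (n - j1)"
        "t \<le> 5 + 65 * ((M + 1 - weight n k1) * (n + 1) + (n - j1))"
        "\<forall>q\<in>set qs. \<exists>k''. q = grid n k'' \<and> weight n k'' \<le> M + 1"
      by force
    have "aval (scalar 4) s < aval (scalar 0) s" using s True by simp
    from exec.WhileTrue[OF this s1(1) IH(1)[unfolded search_def]]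
    have "exec f n search s s2 ([grid n k'] @ qs) (1 + asteps (scalar 4) + asteps (scalar 0) + t1 + t)"
      unfolding search_def .
    moreover have "length ([grid n k'] @ qs) \<le> ?m" using IH(4) k1(3) by simp
    moreover have "1 + asteps (scalar 4) + asteps (scalar 0) + t1 + t \<le> 5 + 65 * ?m"
      using IH(5) s1(2) k1(3) by simp
    moreover have "\<forall>q\<in>set ([grid n k'] @ qs). \<exists>k''. q = grid n k'' \<and> weight n k'' \<le> M + 1"
      using IH(6) w' wM by auto
    ultimately show ?thesis using IH(2,3) by blast
  qed
qed

text \<open>
  Consecutive numbers are coprime, so the fraction is already reduced.
\<close>

lemma quotient_of_growth_power:
  assumes "n \<ge> 1" defines "D \<equiv> 2 * (n * (n + 1))"
  shows "quotient_of (growth n ^ k) = (int (D + 1) ^ k, int D ^ k)"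
proof -
  have D: "D > 0" using assms by simp
  have "growth n = of_int (int (D + 1)) / of_int (int D)"
  proof -
    have "growth n = 1 + 1 / of_nat D" by (simp add: growth_def D_def algebra_simps)
    then show ?thesis using D by (simp add: add_divide_distrib)
  qed
  then have "growth n ^ k = of_int (int (D + 1) ^ k) / of_int (int D ^ k)"
    by (simp only: power_divide of_int_power)
  also have "\<dots> = Fract (int (D + 1) ^ k) (int D ^ k)" by (simp only: Fract_of_int_quotient)
  finally have "quotient_of (growth n ^ k) = Rat.normalize (int (D + 1) ^ k, int D ^ k)"
    by (simp only: quotient_of_Fract)
  also have "\<dots> = (int (D + 1) ^ k, int D ^ k)"
  proof (rule normalize_stable)
    have "coprime (int (D + 1)) (int D)"
      by (simp only: coprime_int_iff) (simp add: coprime_commute)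
    then show "coprime (int (D + 1) ^ k) (int D ^ k)"
      by (simp only: coprime_power_left_iff coprime_power_right_iff) simp
  qed (use D in simp)
  finally show ?thesis .
qed

lemma int_bits_power_le: "int_bits (int a ^ k) \<le> 2 + a * k"
proof -
  have "a ^ k \<le> (2 ^ a) ^ k" by (rule power_mono) (simp_all add: less_imp_le)
  also have "\<dots> < 2 ^ (a * k + 1)" by (simp add: power_mult)
  finally have "floorlog 2 (a ^ k) \<le> a * k + 1" by (intro floorlog_leI) auto
  moreover have "nat \<bar>int a ^ k\<bar> = a ^ k" by (metis abs_of_nat nat_int of_nat_power)
  ultimately show ?thesis by (simp add: int_bits_def)
qed

lemma vector_bits_grid_le:
  assumes n: "n \<ge> 1" and w: "weight n k \<le> W"
  shows "vector_bits (grid n k) \<le> n * (4 + 2 * (2 * (n * (n + 1)) + 1) * W)"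
proof -
  define D where "D = 2 * (n * (n + 1))"
  have "int_bits (fst (quotient_of (growth n ^ k i))) + int_bits (snd (quotient_of (growth n ^ k i)))
      \<le> 4 + 2 * (D + 1) * W" if "i < n" for i
  proof -
    have "k i \<le> weight n k" unfolding weight_def using that by (intro member_le_sum) auto
    then have ki: "k i \<le> W" using w by simp
    have "int_bits (int (D + 1) ^ k i) \<le> 2 + (D + 1) * k i" "int_bits (int D ^ k i) \<le> 2 + D * k i"
      by (rule int_bits_power_le)+
    moreover have "(D + 1) * k i \<le> (D + 1) * W" "D * k i \<le> (D + 1) * W"
      using ki by (rule mult_le_mono2, intro mult_le_mono ki) simp
    ultimately show ?thesis
      unfolding quotient_of_growth_power[OF n, folded D_def] fst_conv snd_conv by linarith
  qed
  then have "(\<Sum>i\<leftarrow>[0..<n]. int_bits (fst (quotient_of (growth n ^ k i))) + int_bits (snd (quotient_of (growth n ^ k i))))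
      \<le> (\<Sum>i\<leftarrow>[0..<n]. 4 + 2 * (D + 1) * W)"
    by (intro sum_list_mono) auto
  then show ?thesis by (simp add: vector_bits_def grid_def o_def sum_list_triv D_def)
qed

section \<open>Correctness and running time\<close>

lemma of_rat_growth: "real_of_rat (growth n) = 1 + 1 / (2 * real n * (real n + 1))"
  by (simp add: growth_def of_rat_add of_rat_divide of_rat_mult mult.assoc)

lemma of_rat_threshold:
  "real_of_rat (threshold n) = real_of_rat (growth n) - (real_of_rat (growth n) - 1)\<^sup>2"
  by (simp add: threshold_def of_rat_diff of_rat_mult power2_eq_square)

text \<open>
  The moves lower the value to \<open>g r\<^sup>w\<close> relative to the product of the coordinates, where
  \<open>r = (1 + \<delta> - \<delta>\<^sup>2) / (1 + \<delta>)\<close> satisfies \<open>ln r \<le> -\<delta>\<^sup>2 / 2\<close>.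
\<close>

lemma ln_ratio_bound:
  fixes \<delta> :: real
  assumes "0 < \<delta>" "\<delta> \<le> 1" "(1 + \<delta>) ^ w \<le> g * (1 + \<delta> - \<delta>\<^sup>2) ^ w" "g > 0"
  shows "real w \<le> 2 * ln g * (1 / \<delta>)\<^sup>2"
proof -
  define r where "r = (1 + \<delta> - \<delta>\<^sup>2) / (1 + \<delta>)"
  have "\<delta>\<^sup>2 \<le> \<delta>" using assms(1,2) mult_left_mono[of \<delta> 1 \<delta>] by (simp add: power2_eq_square)
  then have num: "1 + \<delta> - \<delta>\<^sup>2 > 0" by linarith
  then have r: "r > 0" using assms(1) by (simp add: r_def)
  have "1 \<le> g * r ^ w"
    using assms(1,3) by (simp add: r_def power_divide field_simps)
  then have "ln 1 \<le> ln (g * r ^ w)" by (rule ln_mono) simp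
  then have "0 \<le> ln g + real w * ln r" using r assms(4) by (simp add: ln_mult ln_realpow)
  moreover have "ln r \<le> - (\<delta>\<^sup>2 / 2)"
  proof -
    have "ln r \<le> r - 1" using r by (rule ln_le_minus_one)
    also have "r - 1 = - (\<delta>\<^sup>2 / (1 + \<delta>))" using assms(1) by (simp add: r_def field_simps)
    also have "\<dots> \<le> - (\<delta>\<^sup>2 / 2)"
      using assms(1,2) by (intro le_imp_neg_le divide_left_mono) auto
    finally show ?thesis .
  qed
  then have "real w * ln r \<le> real w * (- (\<delta>\<^sup>2 / 2))" by (rule mult_left_mono) simp
  ultimately have "real w * \<delta>\<^sup>2 \<le> 2 * ln g" by simp
  then show ?thesis using assms(1) by (simp add: field_simps)
qed

text \<open>
  The bound with exponent \<open>8\<close> is dominated by the size of the queried points: \<open>n\<close> coordinates with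
  exponents up to \<open>O(w\<^sup>5)\<close> of a number with \<open>O(w\<^sup>2)\<close> bits by a crude estimate, where \<open>w = 1 + n + ln (p(1, \<dots>, 1))\<close>.
\<close>

lemma prog_correct:
  assumes n: "n \<ge> 1" and hyp: "P_hyperbolic n p" and int: "nonneg_int_coeffs p"
    and orc: "is_oracle_for n p f"
  shows "\<exists>s qs t. exec f n prog (initial_store n) s qs t \<and>
     mixed_derivative n p \<le> real_of_rat (final_output s) \<and>
     real_of_rat (final_output s) \<le> exp 1 ^ n * mixed_derivative n p \<and>
     (let B = real 1000 * (1 + real n + ln (mpoly_eval p (\<lambda>_. 1))) ^ 8 in
        real (length qs) \<le> B \<and> (\<forall>q\<in>set qs. real (vector_bits q) \<le> B) \<and> real t \<le> B)"
proof -
  define ts where "ts = terms_of p"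
  have h: "hyperbolic n n (\<lambda>_. 1) p" using hyp by (simp add: P_hyperbolic_def)
  then have homp: "homogeneous n n p" by (simp add: hyperbolic_def)
  have hom: "homog n n ts" and nn: "nonneg ts" and st: "stable n ts"
    unfolding ts_def using homog_terms_of[OF homp] nonneg_terms_of[OF int]
      P_hyperbolic_imp_stable[OF hyp int n] by auto
  have eval: "mpoly_eval p x = peval n ts x" for x
    unfolding ts_def by (rule mpoly_eval_terms_of[OF homp])
  have p1: "peval n ts (\<lambda>_. 1) > (0::real)" using h by (simp add: hyperbolic_def flip: eval)
  have mixed: "mixed_derivative n p = multilinear_coeff n ts"
    unfolding ts_def by (rule mixed_derivative_eq_multilinear_coeff[OF homp])
  have mixed_nat: "mixed_derivative n p \<in> \<nat>"
    unfolding mixed ts_def by (rule multilinear_coeff_Nats[OF int])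
  define g where "g = mpoly_eval p (\<lambda>_. 1)"
  have g1: "g \<ge> 1"
  proof -
    have "(\<Sum>\<alpha>\<in>A. h \<alpha>) \<in> \<nat>" if "\<And>\<alpha>. h \<alpha> \<in> (\<nat> :: real set)" for A and h :: "(nat \<Rightarrow>\<^sub>0 nat) \<Rightarrow> real"
      using that by (induction A rule: infinite_finite_induct) auto
    then have "g \<in> \<nat>"
      using int by (simp add: g_def mpoly_eval_def mpoly_subst_def nonneg_int_coeffs_def)
    then show ?thesis using p1 by (auto simp: g_def eval elim!: Nats_cases)
  qed
  define D where "D = 2 * real n * (real n + 1)"
  define \<delta> where "\<delta> = 1 / D"
  have "1 * 1 \<le> 2 * real n * (real n + 1)" using n by (intro mult_mono) auto
  then have D1: "D \<ge> 1" by (simp add: D_def)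
  have \<delta>: "\<delta> > 0" "\<delta> \<le> 1" using D1 by (auto simp: \<delta>_def)
  have growth: "real_of_rat (growth n) = 1 + \<delta>" by (simp add: of_rat_growth \<delta>_def D_def)
  have threshold: "real_of_rat (threshold n) = 1 + \<delta> - \<delta>\<^sup>2" by (simp add: of_rat_threshold growth)
  define x where "x = (\<lambda>(k :: nat \<Rightarrow> nat) i. (1 + \<delta>) ^ k i)"
  have x: "x k i > 0" for k i using \<delta> by (simp add: x_def)
  have G: "real_of_rat (f (grid n k)) = peval n ts (x k)" for k
  proof -
    have "length (grid n k) = n" by (simp add: grid_def)
    then have "real_of_rat (f (grid n k)) =
        mpoly_eval p (\<lambda>i. if i < n then real_of_rat (grid n k ! i) else 0)"
      using orc unfolding is_oracle_for_def by blast
    also have "\<dots> = peval n ts (x k)"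
      unfolding eval by (rule peval_cong) (simp add: grid_def x_def of_rat_power growth)
    finally show ?thesis .
  qed
  have W: "real_of_rat (growth n ^ weight n k) = (\<Prod>i<n. x k i)" for k
    by (simp only: of_rat_power growth x_def weight_def) (rule power_sum)
  have Wpos: "(\<Prod>i<n. x k i) > 0" for k using x by (intro prod_pos) auto
  have g0: "real_of_rat (f (grid n (\<lambda>_. 0))) = g" by (simp add: G g_def eval x_def)
  \<comment> \<open>The value relative to the product of the coordinates starts at \<open>g\<close>, and the search goes on only while it
    is at least \<open>1\<close>.\<close>
  define M where "M = nat \<lfloor>2 * ln g * D\<^sup>2\<rfloor>"
  have M: "w \<le> M" if "growth n ^ w \<le> f (grid n (\<lambda>_. 0)) * threshold n ^ w" for w
  proof -
    have "real_of_rat (growth n ^ w) \<le> real_of_rat (f (grid n (\<lambda>_. 0)) * threshold n ^ w)"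
      using that by (simp only: of_rat_less_eq)
    then have "(1 + \<delta>) ^ w \<le> g * (1 + \<delta> - \<delta>\<^sup>2) ^ w"
      by (simp only: of_rat_mult of_rat_power growth threshold g0)
    from ln_ratio_bound[OF \<delta> this] have "real w \<le> 2 * ln g * D\<^sup>2"
      using g1 by (simp add: \<delta>_def)
    then show ?thesis unfolding M_def by (simp add: le_nat_floor)
  qed
  obtain s1 t1 where e1: "exec f n init_loop (initial_store n) s1 [] t1" "t1 \<le> 5 + 20 * n"
    "s1 0 0 = of_nat n" "\<forall>i<n. s1 1 (of_nat i) = 1"
    using exec_init_loop[of "initial_store n" n 0 f] by (auto simp: initial_store_def)
  obtain s2 t2 where e2: "exec f n prepare s1 s2 [grid n (\<lambda>_. 0)] t2" "t2 \<le> 60" "store_repr f n (\<lambda>_. 0) 0 s2"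
    using exec_prepare[where f = f, OF e1(3,4)] by blast
  have "real_of_rat 1 \<le> real_of_rat (f (grid n (\<lambda>_. 0)))" using g1 by (simp add: g0)
  then have "1 \<le> f (grid n (\<lambda>_. 0))" by (simp only: of_rat_less_eq)
  then have inv: "search_inv f n (\<lambda>_. 0) 0" by (simp add: search_inv_def weight_def)
  define m where "m = (M + 1) * (n + 1) + n"
  obtain k s3 qs t3 where e3: "exec f n search s2 s3 qs t3" "store_repr f n k n s3" "search_inv f n k n"
    "length qs \<le> m" "t3 \<le> 5 + 65 * m" "\<forall>q\<in>set qs. \<exists>k''. q = grid n k'' \<and> weight n k'' \<le> M + 1"
    using exec_search[where f = f and M = M, OF n M e2(3) inv] by (auto simp: weight_def m_def)
  obtain s4 t4 where e4: "exec f n report s3 s4 [] t4" "t4 \<le> 20"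
    "final_output s4 = (if f (grid n k) < growth n ^ weight n k then 0
                        else f (grid n k) / growth n ^ weight n k)"
    using exec_report[OF e3(2)] by blast
  define qs' where "qs' = [] @ [grid n (\<lambda>_. 0)] @ qs @ []"
  define t where "t = t1 + (t2 + (t3 + t4))"
  have run: "exec f n prog (initial_store n) s4 qs' t"
    unfolding prog_def qs'_def t_def by (rule exec.Seq[OF e1(1) exec.Seq[OF e2(1) exec.Seq[OF e3(1) e4(1)]]])
  have lower: "mixed_derivative n p * (\<Prod>i<n. x k i) \<le> peval n ts (x k)"
    unfolding mixed by (rule multilinear_coeff_le[OF nn]) (rule x)
  have correct: "mixed_derivative n p \<le> real_of_rat (final_output s4) \<and>
     real_of_rat (final_output s4) \<le> exp 1 ^ n * mixed_derivative n p"
  proof (cases "f (grid n k) < growth n ^ weight n k")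
    case True
    then have "real_of_rat (f (grid n k)) < real_of_rat (growth n ^ weight n k)" by (simp only: of_rat_less)
    then have "mixed_derivative n p * (\<Prod>i<n. x k i) < 1 * (\<Prod>i<n. x k i)"
      using lower by (simp add: G W)
    then have "mixed_derivative n p < 1" using Wpos[of k] by (simp only: mult_less_cancel_right_pos)
    \<comment> \<open>Integrality of the coefficients turns a bound below \<open>1\<close> into exact vanishing.\<close>
    then have "mixed_derivative n p = 0" using mixed_nat by (auto elim!: Nats_cases)
    then show ?thesis using True by (simp add: e4(3))
  next
    case False
    then have out: "real_of_rat (final_output s4) = peval n ts (x k) / (\<Prod>i<n. x k i)"
      by (simp add: e4(3) of_rat_divide G W)
    have "growth n ^ weight n k \<le> f (grid n k)" using False by simp
    then have tested: "\<forall>i<n. threshold n * f (grid n k) \<le> f (grid n (k(i := Suc (k i))))"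
      using e3(3) by (simp add: search_inv_def)
    have "(1 + \<delta> - \<delta>\<^sup>2) * peval n ts (x k) \<le> peval n ts ((x k)(j := x k j * (1 + \<delta>)))" if "j < n" for j
    proof -
      have "real_of_rat (threshold n * f (grid n k)) \<le> real_of_rat (f (grid n (k(j := Suc (k j)))))"
        using tested that by (simp only: of_rat_less_eq)
      moreover have "x (k(j := Suc (k j))) = (x k)(j := x k j * (1 + \<delta>))"
        by (auto simp: x_def fun_eq_iff)
      ultimately show ?thesis by (simp add: of_rat_mult threshold G)
    qed
    then have "peval n ts (x k) / (\<Prod>i<n. x k i) \<le> exp 1 ^ n * multilinear_coeff n ts"
      by (intro stuck_bound[OF st hom nn p1 n _ \<delta>_def[unfolded D_def]] x)
    moreover have "mixed_derivative n p \<le> peval n ts (x k) / (\<Prod>i<n. x k i)"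
      using lower Wpos[of k] by (simp add: pos_le_divide_eq)
    ultimately show ?thesis by (simp add: out mixed)
  qed
  define w where "w = 1 + real n + ln g"
  have L: "ln g \<ge> 0" using g1 by simp
  have w1: "w \<ge> 1" "real n \<le> w" "real n + 1 \<le> w" "ln g \<le> w" using L by (auto simp: w_def)
  have pw: "w ^ a \<le> w ^ b" if "a \<le> b" for a b using w1(1) that by (rule power_increasing[rotated])
  have Dw: "D \<le> 2 * w ^ 2"
  proof -
    have "real n * (real n + 1) \<le> w * w" using w1 by (intro mult_mono) auto
    then show ?thesis by (simp add: D_def power2_eq_square)
  qed
  have Mw: "real M \<le> 8 * w ^ 5"
  proof -
    have "real M \<le> 2 * ln g * D\<^sup>2" unfolding M_def using L by simp
    also have "\<dots> \<le> 2 * w * (2 * w ^ 2)\<^sup>2"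
      using w1 L Dw D1 by (intro mult_mono power_mono) auto
    also have "\<dots> = 8 * w ^ 5" by (simp add: power_mult_distrib flip: power_mult power_Suc)
    finally show ?thesis .
  qed
  have mw: "real m \<le> 10 * w ^ 6"
  proof -
    have "real m = (real M + 1) * (real n + 1) + real n" by (simp add: m_def algebra_simps)
    also have "\<dots> \<le> (8 * w ^ 5 + 1) * w + w" using Mw w1 by (intro add_mono mult_mono) auto
    also have "\<dots> = 8 * w ^ 6 + 2 * w ^ 1" by (simp add: algebra_simps flip: power_Suc)
    also have "\<dots> \<le> 8 * w ^ 6 + 2 * w ^ 6" by (intro add_mono mult_left_mono pw) auto
    finally show ?thesis by simp
  qed
  have len: "real (length qs') \<le> 1000 * w ^ 8"
  proof -
    have "real (length qs') \<le> 1 + real m" using e3(4) by (simp add: qs'_def)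
    then show ?thesis using mw pw[of 0 8] pw[of 6 8] by simp
  qed
  have time: "real t \<le> 1000 * w ^ 8"
  proof -
    have "t \<le> (5 + 20 * n) + (60 + ((5 + 65 * m) + 20))"
      unfolding t_def using e1(2) e2(2) e3(5) e4(2) by linarith
    then have "real t \<le> real ((5 + 20 * n) + (60 + ((5 + 65 * m) + 20)))" by (rule of_nat_mono)
    then have "real t \<le> 90 + 20 * real n + 65 * real m" by simp
    then show ?thesis using mw w1 pw[of 0 8] pw[of 1 8] pw[of 6 8] by simp
  qed
  have bits: "real (vector_bits q) \<le> 1000 * w ^ 8" if "q \<in> set qs'" for q
  proof -
    obtain k'' where q: "q = grid n k''" "weight n k'' \<le> M + 1"
      using \<open>q \<in> set qs'\<close> e3(6) by (auto simp: qs'_def weight_def)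
    have "real (vector_bits q) \<le> real (n * (4 + 2 * (2 * (n * (n + 1)) + 1) * (M + 1)))"
      unfolding q(1) by (intro of_nat_mono vector_bits_grid_le n q(2))
    also have "\<dots> = real n * (4 + 2 * (D + 1) * (real M + 1))" by (simp add: D_def algebra_simps)
    also have "\<dots> \<le> w * (4 + 2 * (2 * w ^ 2 + 1) * (8 * w ^ 5 + 1))"
      using w1 Dw Mw D1 by (intro mult_mono add_mono) auto
    also have "\<dots> = 6 * w ^ 1 + 32 * w ^ 8 + 16 * w ^ 6 + 4 * w ^ 3"
      by (simp add: algebra_simps eval_nat_numeral)
    also have "\<dots> \<le> 6 * w ^ 8 + 32 * w ^ 8 + 16 * w ^ 8 + 4 * w ^ 8"
      by (intro add_mono mult_left_mono pw) auto
    finally show ?thesis using pw[of 0 8] by simp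
  qed
  show ?thesis
    using run correct len time bits unfolding Let_def g_def[symmetric] w_def[symmetric]
    by (intro exI[of _ s4] exI[of _ qs'] exI[of _ t]) simp
qed

lemma oracle_exists:
  assumes "nonneg_int_coeffs p" shows "\<exists>f. is_oracle_for n p f"
proof -
  have sum: "(\<Sum>\<alpha>\<in>A. h \<alpha>) \<in> \<rat>" if "\<And>\<alpha>. h \<alpha> \<in> \<rat>" for A and h :: "(nat \<Rightarrow>\<^sub>0 nat) \<Rightarrow> real"
    using that by (induction A rule: infinite_finite_induct) auto
  have prod: "(\<Prod>i\<in>A. h i) \<in> \<rat>" if "\<And>i. h i \<in> \<rat>" for A and h :: "nat \<Rightarrow> real"
    using that by (induction A rule: infinite_finite_induct) auto
  have lookup: "Poly_Mapping.lookup p \<alpha> \<in> \<rat>" for \<alpha>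
    using assms unfolding nonneg_int_coeffs_def by (metis Nats_cases Rats_of_nat)
  have "mpoly_eval p (\<lambda>i. if i < n then real_of_rat (q ! i) else 0) \<in> \<rat>" for q
    unfolding mpoly_eval_def mpoly_subst_def
    by (intro sum Rats_mult lookup prod Rats_power) simp
  then have "\<exists>r. real_of_rat r = mpoly_eval p (\<lambda>i. if i < n then real_of_rat (q ! i) else 0)" for q
    by (metis Rats_cases)
  then show ?thesis unfolding is_oracle_for_def by metis
qed

text \<open>
  Hence the computed number depends on the polynomial alone.
\<close>

lemma oracle_unique:
  assumes "is_oracle_for n p f" "is_oracle_for n p f'" "length q = n"
  shows "f q = f' q"
  using assms unfolding is_oracle_for_def by (metis of_rat_eq_iff)

theorem theorem3p1:
  "\<exists>(c :: com) (F :: nat \<Rightarrow> mpoly \<Rightarrow> rat).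
     det_poly_time_oracle_computes c
       (\<lambda>n p. n \<ge> 1 \<and> P_hyperbolic n p \<and> nonneg_int_coeffs p) F \<and>
     (\<forall>n p. n \<ge> 1 \<and> P_hyperbolic n p \<and> nonneg_int_coeffs p \<longrightarrow>
        mixed_derivative n p \<le> real_of_rat (F n p) \<and>
        real_of_rat (F n p) \<le> exp 1 ^ n * mixed_derivative n p)"
proof -
  \<comment> \<open>The output must be a function of \<open>n\<close> and \<open>p\<close>, whereas a run refers to an evaluation function \<open>f\<close>; all
    choices of \<open>f\<close> lead to the same run.\<close>
  define F where "F = (\<lambda>n p. SOME v. \<exists>f s qs t. is_oracle_for n p f \<and>
     exec f n prog (initial_store n) s qs t \<and> final_output s = v)"
  have F: "final_output s = F n p"
    if f: "is_oracle_for n p f" and ex: "exec f n prog (initial_store n) s qs t" for n p f s qs t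
  proof -
    have "\<exists>v f s qs t. is_oracle_for n p f \<and> exec f n prog (initial_store n) s qs t \<and> final_output s = v"
      using that by blast
    then have "\<exists>f s qs t. is_oracle_for n p f \<and> exec f n prog (initial_store n) s qs t \<and> final_output s = F n p"
      unfolding F_def by (rule someI_ex)
    then obtain f' s' qs' t' where *: "is_oracle_for n p f'"
      "exec f' n prog (initial_store n) s' qs' t'" "final_output s' = F n p" by blast
    have "exec f n prog (initial_store n) s' qs' t'"
      by (rule exec_cong[OF *(2)]) (rule oracle_unique[OF *(1) f])
    then have "s' = s" using exec_deterministic[OF ex] by blast
    then show ?thesis using *(3) by simp
  qed
  have bounds: "mixed_derivative n p \<le> real_of_rat (F n p) \<and>
      real_of_rat (F n p) \<le> exp 1 ^ n * mixed_derivative n p"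
    if D: "n \<ge> 1 \<and> P_hyperbolic n p \<and> nonneg_int_coeffs p" for n p
  proof -
    obtain f where f: "is_oracle_for n p f" using oracle_exists[of p n] D by blast
    obtain s qs t where "exec f n prog (initial_store n) s qs t"
      "mixed_derivative n p \<le> real_of_rat (final_output s)"
      "real_of_rat (final_output s) \<le> exp 1 ^ n * mixed_derivative n p"
      using prog_correct[of n p f] D f by blast
    then show ?thesis using F[OF f] by simp
  qed
  have poly_time: "det_poly_time_oracle_computes prog
      (\<lambda>n p. n \<ge> 1 \<and> P_hyperbolic n p \<and> nonneg_int_coeffs p) F"
    unfolding det_poly_time_oracle_computes_def
  proof (rule exI[of _ 1000], rule exI[of _ 8], intro allI impI)
    fix n p f
    assume D: "n \<ge> 1 \<and> P_hyperbolic n p \<and> nonneg_int_coeffs p" and f: "is_oracle_for n p f"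
    obtain s qs t where ex: "exec f n prog (initial_store n) s qs t"
      and B: "let B = real 1000 * (1 + real n + ln (mpoly_eval p (\<lambda>_. 1))) ^ 8 in
        real (length qs) \<le> B \<and> (\<forall>q\<in>set qs. real (vector_bits q) \<le> B) \<and> real t \<le> B"
      using prog_correct[of n p f] D f by blast
    show "\<exists>s qs t. exec f n prog (initial_store n) s qs t \<and> final_output s = F n p \<and>
        (let B = real 1000 * (1 + real n + ln (mpoly_eval p (\<lambda>_. 1))) ^ 8 in
        real (length qs) \<le> B \<and> (\<forall>q\<in>set qs. real (vector_bits q) \<le> B) \<and> real t \<le> B)"
      using ex F[OF f ex] B by blast
  qed
  show ?thesis using poly_time bounds by blast
qed

end
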